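(* Let $(X_N,x_N,d_N,M_N)_{N\in\mathbb N}$ be a sequence of pointed proper metric spaces endowed with random point processes which converges in the random pointed Lipschitz sense towards $(X,x,d,M)$, where all the point processes are simple and satisfy $M_N(\{x_N\})=0$, $M(\{x\})=0$ almost surely. Assume that $(X,x,d,M)$ is regular. Then, for any fixed $L>0$, the random rooted graphs $\Gamma_{\mathrm{geom}}(X_N,x_N,d_N,M_N,L)$ converge in the local Benjamini--Schramm sense towards $\Gamma_{\mathrm{geom}}(X,x,d,M,L)$.
   Context: A metric space is proper if closed balls are compact. A random point process is a random locally finite sum of Dirac masses $\sum_i\delta_{x_i}$; simple means no atom has multiplicity $>1$. For a homeomorphism $f$, $\mathrm{dil}(f)=\sup_{y\ne z}d'(f(y),f(z))/d(y,z)$. Random pointed Lipschitz convergence $(X_N,x_N,d_N,M_N)\to(X,x,d,M)$: for every $R>0$ there is $N_0(R)$ such that for $N\ge N_0(R)$ there are homeomorphisms $f_{N,R}:B^{X_N}(x_N,R)\to B^X(x,R)$ with $|\log\mathrm{dil}f_{N,R}|+|\log\mathrm{dil}f^{-1}_{N,R}|+d(f_{N,R}(x_N),x)+d_N(x_N,f_{N,R}^{-1}(x))\to0$, and such that for every continuous $\phi:X\to\mathbb R$ compactly supported in the open ball of radius $R$ around $x$, $\sum\phi(f_{N,R}(a))$ over atoms $a$ of $M_N$ in $B^{X_N}(x_N,R)$ converges in law to $\sum\phi(a)$ over atoms $a$ of $M$ in $B^X(x,R)$. $\Gamma_{\mathrm{geom}}(X,x,d,M,L)$ is the graph with vertex set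 $\{x\}\cup\{$atoms of $M\}$, edges between points at distance $\le L$, rooted at $x$ and restricted to the connected component of $x$. Local topology on rooted locally finite connected graphs: $(\Gamma_n,r_n)\to(\Gamma,r)$ iff for each $k$, the balls of graph radius $k$ around the roots are eventually rooted-isomorphic; local Benjamini--Schramm convergence of random rooted graphs is weak convergence of their laws for this topology (equivalently, convergence of the probabilities of each finite radius-$k$ ball). $(X,x,d,M)$ is regular if, for every fixed $L>0$, the map $l\mapsto\Gamma_{\mathrm{geom}}(X,x,d,M,l)$ is almost surely continuous at $l=L$ for the local topology. *)

theory Defs
  imports "HOL-Analysis.Analysis" "HOL-Probability.Probability"
begin

definition proper_mspace :: "'a set \<Rightarrow> ('a \<Rightarrow> 'a \<Rightarrow> real) \<Rightarrow> bool" where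
  "proper_mspace X d \<longleftrightarrow> Metric_space X d \<and>
     (\<forall>y\<in>X. \<forall>r. compactin (Metric_space.mtopology X d) (Metric_space.mcball X d y r))"

definition mborel_sets :: "'a set \<Rightarrow> ('a \<Rightarrow> 'a \<Rightarrow> real) \<Rightarrow> 'a set set" where
  "mborel_sets X d = sigma_sets X {U. openin (Metric_space.mtopology X d) U}"

text \<open>A simple random point process on (X,d) over the probability space P: a random
  locally finite subset of X (the set of atoms; simplicity = all multiplicities are 1),
  such that the number of atoms in every bounded Borel set is a random variable.\<close>
definition simple_point_process :: "'w measure \<Rightarrow> 'a set \<Rightarrow> ('a \<Rightarrow> 'a \<Rightarrow> real) \<Rightarrow> ('w \<Rightarrow> 'a set) \<Rightarrow> bool" where
  "simple_point_process P X d M \<longleftrightarrow>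
     (\<forall>\<omega>\<in>space P. M \<omega> \<subseteq> X \<and> (\<forall>y\<in>X. \<forall>r. finite (M \<omega> \<inter> Metric_space.mcball X d y r))) \<and>
     (\<forall>B. B \<in> mborel_sets X d \<and> Metric_space.mbounded X d B \<longrightarrow>
          (\<lambda>\<omega>. card (M \<omega> \<inter> B)) \<in> measurable P (count_space UNIV))"

definition conv_in_law :: "(nat \<Rightarrow> 'w measure) \<Rightarrow> (nat \<Rightarrow> 'w \<Rightarrow> real) \<Rightarrow> 'v measure \<Rightarrow> ('v \<Rightarrow> real) \<Rightarrow> bool" where
  "conv_in_law Pn Y P Z \<longleftrightarrow>
     (\<forall>\<^sub>F N in sequentially. Y N \<in> borel_measurable (Pn N)) \<and> Z \<in> borel_measurable P \<and>
     (\<forall>g::real \<Rightarrow> real. continuous_on UNIV g \<and> bounded (range g) \<longrightarrow>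
        (\<lambda>N. integral\<^sup>L (Pn N) (\<lambda>\<omega>. g (Y N \<omega>))) \<longlonglongrightarrow> integral\<^sup>L P (\<lambda>\<omega>. g (Z \<omega>)))"

definition dil_set :: "'a set \<Rightarrow> ('a \<Rightarrow> 'a \<Rightarrow> real) \<Rightarrow> ('b \<Rightarrow> 'b \<Rightarrow> real) \<Rightarrow> ('a \<Rightarrow> 'b) \<Rightarrow> real set" where
  "dil_set A d d' f = {d' (f y) (f z) / d y z | y z. y \<in> A \<and> z \<in> A \<and> y \<noteq> z}"

text \<open>dil f = sup over y \<noteq> z of d'(f y, f z)/d(y,z); convention 1 on a one-point domain.\<close>
definition dil :: "'a set \<Rightarrow> ('a \<Rightarrow> 'a \<Rightarrow> real) \<Rightarrow> ('b \<Rightarrow> 'b \<Rightarrow> real) \<Rightarrow> ('a \<Rightarrow> 'b) \<Rightarrow> real" where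
  "dil A d d' f = (if dil_set A d d' f = {} then 1 else Sup (dil_set A d d' f))"

definition cc_in_ball :: "'b set \<Rightarrow> ('b \<Rightarrow> 'b \<Rightarrow> real) \<Rightarrow> 'b \<Rightarrow> real \<Rightarrow> ('b \<Rightarrow> real) \<Rightarrow> bool" where
  "cc_in_ball X d x R \<phi> \<longleftrightarrow>
     continuous_map (Metric_space.mtopology X d) euclideanreal \<phi> \<and>
     (\<exists>K. compactin (Metric_space.mtopology X d) K \<and> K \<subseteq> Metric_space.mball X d x R \<and>
          (\<forall>y\<in>X - K. \<phi> y = 0))"

definition random_pointed_lip_conv ::
  "(nat \<Rightarrow> 'a set) \<Rightarrow> (nat \<Rightarrow> 'a) \<Rightarrow> (nat \<Rightarrow> 'a \<Rightarrow> 'a \<Rightarrow> real) \<Rightarrow> (nat \<Rightarrow> 'w measure) \<Rightarrow> (nat \<Rightarrow> 'w \<Rightarrow> 'a set)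
   \<Rightarrow> 'b set \<Rightarrow> 'b \<Rightarrow> ('b \<Rightarrow> 'b \<Rightarrow> real) \<Rightarrow> 'v measure \<Rightarrow> ('v \<Rightarrow> 'b set) \<Rightarrow> bool" where
  "random_pointed_lip_conv XN xN dN PN MN X x d P M \<longleftrightarrow>
     (\<forall>R>0. \<exists>N0. \<exists>(f :: nat \<Rightarrow> 'a \<Rightarrow> 'b) (g :: nat \<Rightarrow> 'b \<Rightarrow> 'a).
        (\<forall>N\<ge>N0.
           homeomorphic_maps
             (subtopology (Metric_space.mtopology (XN N) (dN N)) (Metric_space.mcball (XN N) (dN N) (xN N) R))
             (subtopology (Metric_space.mtopology X d) (Metric_space.mcball X d x R))
             (f N) (g N) \<and>
           bdd_above (dil_set (Metric_space.mcball (XN N) (dN N) (xN N) R) (dN N) d (f N)) \<and>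
           bdd_above (dil_set (Metric_space.mcball X d x R) d (dN N) (g N))) \<and>
        (\<lambda>N. \<bar>ln (dil (Metric_space.mcball (XN N) (dN N) (xN N) R) (dN N) d (f N))\<bar>
            + \<bar>ln (dil (Metric_space.mcball X d x R) d (dN N) (g N))\<bar>
            + d (f N (xN N)) x + dN N (xN N) (g N x)) \<longlonglongrightarrow> 0 \<and>
        (\<forall>\<phi>. cc_in_ball X d x R \<phi> \<longrightarrow>
           conv_in_law PN
             (\<lambda>N \<omega>. \<Sum>a \<in> MN N \<omega> \<inter> Metric_space.mcball (XN N) (dN N) (xN N) R. \<phi> (f N a))
             P (\<lambda>\<omega>. \<Sum>a \<in> M \<omega> \<inter> Metric_space.mcball X d x R. \<phi> a)))"

definition geom_edge :: "('a \<Rightarrow> 'a \<Rightarrow> real) \<Rightarrow> 'a \<Rightarrow> 'a set \<Rightarrow> real \<Rightarrow> 'a \<Rightarrow> 'a \<Rightarrow> bool" where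
  "geom_edge d x S L y z \<longleftrightarrow> y \<in> insert x S \<and> z \<in> insert x S \<and> y \<noteq> z \<and> d y z \<le> L"

text \<open>Vertices at graph distance \<le> k from the root r (automatically inside the component of r).\<close>
fun gball :: "('a \<Rightarrow> 'a \<Rightarrow> bool) \<Rightarrow> 'a \<Rightarrow> nat \<Rightarrow> 'a set" where
  "gball E r 0 = {r}"
| "gball E r (Suc k) = gball E r k \<union> {z. \<exists>y\<in>gball E r k. E y z}"

definition rball_iso :: "('a \<Rightarrow> 'a \<Rightarrow> bool) \<Rightarrow> 'a \<Rightarrow> ('b \<Rightarrow> 'b \<Rightarrow> bool) \<Rightarrow> 'b \<Rightarrow> nat \<Rightarrow> bool" where
  "rball_iso E r E' r' k \<longleftrightarrow> (\<exists>h. bij_betw h (gball E r k) (gball E' r' k) \<and> h r = r' \<and>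
      (\<forall>y\<in>gball E r k. \<forall>z\<in>gball E r k. E y z \<longleftrightarrow> E' (h y) (h z)))"

text \<open>Regularity: for every L > 0, almost surely l \<mapsto> Gamma_geom(X,x,d,M,l) is continuous at L
  for the local topology.\<close>
definition regular :: "'b set \<Rightarrow> 'b \<Rightarrow> ('b \<Rightarrow> 'b \<Rightarrow> real) \<Rightarrow> 'v measure \<Rightarrow> ('v \<Rightarrow> 'b set) \<Rightarrow> bool" where
  "regular X x d P M \<longleftrightarrow>
     (\<forall>L>0. AE \<omega> in P. \<forall>k. \<exists>\<delta>>0. \<forall>l. \<bar>l - L\<bar> < \<delta> \<longrightarrow>
         rball_iso (geom_edge d x (M \<omega>) l) x (geom_edge d x (M \<omega>) L) x k)"

definition BS_conv :: "(nat \<Rightarrow> 'w measure) \<Rightarrow> (nat \<Rightarrow> 'w \<Rightarrow> 'a \<Rightarrow> 'a \<Rightarrow> bool) \<Rightarrow> (nat \<Rightarrow> 'a)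
    \<Rightarrow> 'v measure \<Rightarrow> ('v \<Rightarrow> 'b \<Rightarrow> 'b \<Rightarrow> bool) \<Rightarrow> 'b \<Rightarrow> bool" where
  "BS_conv PN EN rN P E r \<longleftrightarrow>
     (\<forall>k (H :: nat \<Rightarrow> nat \<Rightarrow> bool) h0.
        (\<forall>N. {\<omega> \<in> space (PN N). rball_iso (EN N \<omega>) (rN N) H h0 k} \<in> sets (PN N)) \<and>
        {\<omega> \<in> space P. rball_iso (E \<omega>) r H h0 k} \<in> sets P \<and>
        (\<lambda>N. measure (PN N) {\<omega> \<in> space (PN N). rball_iso (EN N \<omega>) (rN N) H h0 k})
          \<longlonglongrightarrow> measure P {\<omega> \<in> space P. rball_iso (E \<omega>) r H h0 k})"

end

theory Submission
  imports Defs
begin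

text \<open>
  The random variables \<open>exp (- \<Sum>a. \<phi> a)\<close>, \<open>\<phi> \<ge> 0\<close>, form a bounded family closed under multiplication,
  so by Weierstrass' theorem convergence in law of each single linear statistic already gives convergence
  of the expectation of every functional in the algebra they generate under continuous operations.
  That algebra contains functionals detecting a pattern: there is an atom near each of finitely many
  prescribed points and there are no further atoms in a large ball. Regularity says that almost
  surely no pair of points meeting the ball of graph radius \<open>k\<close> is at distance exactly \<open>L\<close>, hence
  that ball is determined by a fine enough pattern of the limit, and the same pattern observed in
  \<open>X\<^sub>N\<close> for large \<open>N\<close> forces an isomorphic ball. Covering the limit space by countably many patterns
  bounds from below the limit inferior of the probability of an isomorphism class of balls and of
  its complement.
\<close>

subsection \<open>Rooted balls\<close>

text \<open>The hypothesis gives no joint convergence of several statistics, and numbers of atoms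
  are unbounded. Both obstacles vanish because a sum of test functions is again a test function, so
  that a product of exponentials is a single statistic, and because the exponential of a nonpositive
  number is bounded.

  A pattern has to be a continuous functional, so it cannot jump from 0 to 1. What counts is the
  slack between the two ends: the limit configuration meets strict conditions that give the value 1,
  while positivity forces weaker conditions on a configuration of \<open>X_N\<close>, and these
  still determine the ball. Absence of further atoms is expressed as a cap on their number: once
  distinct atoms are found near all prescribed points, the cap leaves no room for others.

  For fixed \<open>k\<close> everything happens within distance \<open>k * L + 5\<close> of the
  root, so one radius and one family of homeomorphisms suffice. Rounding to a dense sequence at the
  scales \<open>1 / (m + 1)\<close> makes the patterns countable. It also yields measurability of
  the ball events, which is not immediate since a point process is known only through counts in
  Borel sets.\<close>

lemma root_in_gball: "r \<in> gball E r k"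
  by (induction k) auto

lemma gball_mono: "j \<le> k \<Longrightarrow> gball E r j \<subseteq> gball E r k"
  by (induction k) (auto simp: le_Suc_eq)

lemma gball_mono_edges:
  assumes "\<And>y z. E y z \<Longrightarrow> E' y z"
  shows "gball E r k \<subseteq> gball E' r k"
  by (induction k) (use assms in auto)

lemma rball_iso_sym:
  assumes "rball_iso E r E' r' k"
  shows "rball_iso E' r' E r k"
proof -
  obtain h where h: "bij_betw h (gball E r k) (gball E' r' k)" "h r = r'"
    and e: "\<forall>y\<in>gball E r k. \<forall>z\<in>gball E r k. E y z \<longleftrightarrow> E' (h y) (h z)"
    using assms unfolding rball_iso_def by blast
  let ?g = "inv_into (gball E r k) h"
  have g: "bij_betw ?g (gball E' r' k) (gball E r k)"
    using h(1) by (rule bij_betw_inv_into)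
  have "?g r' = r"
    using h root_in_gball[of r E k] by (metis bij_betw_inv_into_left)
  moreover have "E' y z \<longleftrightarrow> E (?g y) (?g z)" if "y \<in> gball E' r' k" "z \<in> gball E' r' k" for y z
    using e that bij_betwE[OF g] bij_betw_inv_into_right[OF h(1)] by metis
  ultimately show ?thesis
    unfolding rball_iso_def using g by blast
qed

lemma rball_iso_trans:
  assumes "rball_iso E r E' r' k" "rball_iso E' r' E'' r'' k"
  shows "rball_iso E r E'' r'' k"
proof -
  obtain h where h: "bij_betw h (gball E r k) (gball E' r' k)" "h r = r'"
    "\<forall>y\<in>gball E r k. \<forall>z\<in>gball E r k. E y z \<longleftrightarrow> E' (h y) (h z)"
    using assms(1) unfolding rball_iso_def by blast
  obtain g where g: "bij_betw g (gball E' r' k) (gball E'' r'' k)" "g r' = r''"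
    "\<forall>y\<in>gball E' r' k. \<forall>z\<in>gball E' r' k. E' y z \<longleftrightarrow> E'' (g y) (g z)"
    using assms(2) unfolding rball_iso_def by blast
  have "bij_betw (g \<circ> h) (gball E r k) (gball E'' r'' k)"
    using h(1) g(1) by (rule bij_betw_trans)
  moreover have "(g \<circ> h) r = r''"
    using h g by simp
  moreover have "E y z \<longleftrightarrow> E'' ((g \<circ> h) y) ((g \<circ> h) z)"
    if "y \<in> gball E r k" "z \<in> gball E r k" for y z
    using that h(3) g(3) bij_betwE[OF h(1)] by simp
  ultimately show ?thesis
    unfolding rball_iso_def by blast
qed

lemma rball_iso_cong:
  assumes "rball_iso E r E' r' k"
  shows "rball_iso E r H h0 k \<longleftrightarrow> rball_iso E' r' H h0 k"
  using rball_iso_trans[OF assms, of H h0] rball_iso_trans[OF rball_iso_sym[OF assms], of H h0] by metis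

text \<open>Induction on the radius: \<open>h\<close> carries each smaller ball onto its
  counterpart, since the next layers stay inside \<open>V\<close> and its image, where neighbours
  can be compared. Adjacency is compared only for pairs with one end in the ball, because in the
  application distance exactly \<open>L\<close> is excluded only for such pairs.\<close>

lemma rball_isoI:
  assumes inj: "inj_on h V" and root: "h r = r'"
    and V: "gball E r k \<subseteq> V" and V': "gball E' r' k \<subseteq> h ` V"
    and adj: "\<And>y z. y \<in> gball E r k \<Longrightarrow> z \<in> V \<Longrightarrow> E y z \<longleftrightarrow> E' (h y) (h z)"
  shows "rball_iso E r E' r' k"
proof -
  have im: "h ` gball E r j = gball E' r' j" if "j \<le> k" for j
    using that
  proof (induction j)
    case 0
    then show ?case by (simp add: root)
  next
    case (Suc j)
    have IH: "h ` gball E r j = gball E' r' j"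
      using Suc by simp
    have inV: "gball E r (Suc j) \<subseteq> V" "gball E' r' (Suc j) \<subseteq> h ` V"
      and ink: "gball E r j \<subseteq> gball E r k"
      using gball_mono Suc.prems V V' by (meson order_trans Suc_leD)+
    show ?case
    proof (intro equalityI subsetI)
      fix w assume "w \<in> h ` gball E r (Suc j)"
      then obtain z where z: "z \<in> gball E r (Suc j)" "w = h z" by blast
      show "w \<in> gball E' r' (Suc j)"
      proof (cases "z \<in> gball E r j")
        case True
        then show ?thesis using IH z by auto
      next
        case False
        then obtain y where y: "y \<in> gball E r j" "E y z" using z by auto
        have "E' (h y) (h z)"
          using adj[of y z] y z inV ink by blast
        then show ?thesis
          using y(1) IH z by auto
      qed
    next
      fix w assume w: "w \<in> gball E' r' (Suc j)"
      show "w \<in> h ` gball E r (Suc j)"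
      proof (cases "w \<in> gball E' r' j")
        case True
        then show ?thesis using IH by auto
      next
        case False
        then obtain y' where "y' \<in> h ` gball E r j" "E' y' w"
          using w IH by auto
        then obtain y where y: "y \<in> gball E r j" "E' (h y) w" by auto
        obtain z where z: "z \<in> V" "w = h z" using subsetD[OF inV(2) w] by (rule imageE)
        have "E y z"
          using adj[of y z] y z ink by blast
        then show ?thesis
          using y(1) z by auto
      qed
    qed
  qed
  have "bij_betw h (gball E r k) (gball E' r' k)"
    unfolding bij_betw_def using im[of k] inj_on_subset[OF inj V] by simp
  then show ?thesis
    unfolding rball_iso_def using root adj V by blast
qed

text \<open>An isomorphism between two nested finite balls forces them to have equally many edges,
  hence the same edges.\<close>
lemma rball_iso_subgraph_imp_eq:
  assumes sub: "\<And>y z. E y z \<Longrightarrow> E' y z" and fin: "finite (gball E' r k)"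
    and iso: "rball_iso E r E' r k"
    and yz: "y \<in> gball E' r k" "z \<in> gball E' r k" "E' y z"
  shows "E y z"
proof -
  obtain h where h: "bij_betw h (gball E r k) (gball E' r k)"
    and e: "\<forall>y\<in>gball E r k. \<forall>z\<in>gball E r k. E y z \<longleftrightarrow> E' (h y) (h z)"
    using iso unfolding rball_iso_def by blast
  have "gball E r k \<subseteq> gball E' r k"
    using sub by (rule gball_mono_edges)
  then have eq: "gball E r k = gball E' r k"
    using bij_betw_same_card[OF h] fin by (intro card_subset_eq) auto
  define B where "B = gball E' r k"
  have bB: "bij_betw h B B"
    using h eq by (simp add: B_def)
  have hB: "h ` B = B"
    using bB by (simp add: bij_betw_def)
  have B: "finite B" "inj_on h B"
    using bB fin by (auto simp: bij_betw_def B_def)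
  let ?F = "\<lambda>E. {(y, z). y \<in> B \<and> z \<in> B \<and> E y z}"
  have eB: "E y z \<longleftrightarrow> E' (h y) (h z)" if "y \<in> B" "z \<in> B" for y z
    using e eq that by (auto simp: B_def)
  have fin2: "finite (?F E')"
    by (rule finite_subset[of _ "B \<times> B"]) (use B in auto)
  have "map_prod h h ` ?F E = ?F E'"
  proof (intro equalityI subsetI)
    fix p assume "p \<in> map_prod h h ` ?F E"
    then show "p \<in> ?F E'"
      using eB hB by auto
  next
    fix p assume "p \<in> ?F E'"
    then obtain u v where uv: "p = (u, v)" "u \<in> B" "v \<in> B" "E' u v" by blast
    then obtain u0 v0 where "u = h u0" "v = h v0" "u0 \<in> B" "v0 \<in> B"
      using hB by (metis imageE)
    then show "p \<in> map_prod h h ` ?F E"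
      using uv eB by (auto intro!: image_eqI[of _ _ "(u0, v0)"])
  qed
  moreover have "card (map_prod h h ` ?F E) = card (?F E)"
  proof (rule card_image)
    have "inj_on (map_prod h h) (B \<times> B)"
      using B by (intro map_prod_inj_on)
    then show "inj_on (map_prod h h) (?F E)"
      by (rule inj_on_subset) auto
  qed
  ultimately have "card (?F E) = card (?F E')" by simp
  moreover have "?F E \<subseteq> ?F E'" using sub by auto
  ultimately have "?F E = ?F E'"
    using fin2 card_subset_eq by blast
  then show ?thesis
    using yz by (auto simp: B_def)
qed

section \<open>Balls of geometric graphs\<close>

lemma gball_geom_edge_vertices: "gball (geom_edge d x S L) x k \<subseteq> insert x S"
proof (induction k)
  case (Suc k)
  have "z \<in> insert x S" if "geom_edge d x S L y z" for y z
    using that by (simp add: geom_edge_def)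
  then show ?case using Suc by auto
qed simp

text \<open>Each of the \<open>k\<close> steps has length at most \<open>L\<close>. This confines
  combinatorial balls to metric balls, where local finiteness applies.\<close>

lemma (in Metric_space) gball_geom_edge_subset:
  assumes "x \<in> M" "S \<subseteq> M" "L \<ge> 0"
  shows "gball (geom_edge d x S L) x k \<subseteq> {y \<in> insert x S. d x y \<le> real k * L}"
proof (induction k)
  case 0
  then show ?case using assms by auto
next
  case (Suc k)
  have "d x z \<le> real (Suc k) * L"
    if "y \<in> gball (geom_edge d x S L) x k" "geom_edge d x S L y z" for y z
  proof -
    have "d x y \<le> real k * L"
      using that(1) Suc by blast
    moreover have "y \<in> M" "z \<in> M" "d y z \<le> L"
      using that(2) assms by (auto simp: geom_edge_def)
    ultimately show ?thesis
      using triangle[of x y z] assms by (simp add: algebra_simps)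
  qed
  moreover have "d x z \<le> real (Suc k) * L" if "z \<in> gball (geom_edge d x S L) x k" for z
  proof -
    have "d x z \<le> real k * L" using that Suc by auto
    then show ?thesis using assms(3) by (simp add: algebra_simps)
  qed
  ultimately show ?case
    using gball_geom_edge_vertices[of d x S L "Suc k"] by auto
qed

subsection \<open>Convergence of expectations for an algebra of functionals\<close>

inductive_set lin_comb :: "('c \<Rightarrow> real) set \<Rightarrow> ('c \<Rightarrow> real) set" for \<Phi> where
  gen: "U \<in> \<Phi> \<Longrightarrow> (\<lambda>s. c * U s) \<in> lin_comb \<Phi>"
| add: "F \<in> lin_comb \<Phi> \<Longrightarrow> G \<in> lin_comb \<Phi> \<Longrightarrow> (\<lambda>s. F s + G s) \<in> lin_comb \<Phi>"

text \<open>Products and continuous functions of one variable are enough: soft conditions on single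
  statistics are combined by products, and a soft union is 1 minus a product.\<close>

inductive_set cont_algebra :: "('c \<Rightarrow> real) set \<Rightarrow> ('c \<Rightarrow> real) set" for \<Phi> where
  gen: "U \<in> \<Phi> \<Longrightarrow> U \<in> cont_algebra \<Phi>"
| mult: "F \<in> cont_algebra \<Phi> \<Longrightarrow> G \<in> cont_algebra \<Phi> \<Longrightarrow> (\<lambda>s. F s * G s) \<in> cont_algebra \<Phi>"
| comp: "F \<in> cont_algebra \<Phi> \<Longrightarrow> continuous_on UNIV (h :: real \<Rightarrow> real) \<Longrightarrow>
    (\<lambda>s. h (F s)) \<in> cont_algebra \<Phi>"

definition unif_approx :: "('c \<Rightarrow> real) set \<Rightarrow> ('c \<Rightarrow> real) \<Rightarrow> bool" where
  "unif_approx \<Phi> F \<longleftrightarrow> (\<forall>e>0. \<exists>G\<in>lin_comb \<Phi>. \<forall>s. \<bar>F s - G s\<bar> \<le> e)"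

lemma unif_approx_lin_comb: "F \<in> lin_comb \<Phi> \<Longrightarrow> unif_approx \<Phi> F"
  unfolding unif_approx_def by (metis abs_0 cancel_comm_monoid_add_class.diff_cancel less_imp_le)

lemma unif_approx_add:
  assumes "unif_approx \<Phi> F" "unif_approx \<Phi> G"
  shows "unif_approx \<Phi> (\<lambda>s. F s + G s)"
  unfolding unif_approx_def
proof (intro allI impI)
  fix e :: real assume "e > 0"
  then obtain F' G' where FG: "F' \<in> lin_comb \<Phi>" "G' \<in> lin_comb \<Phi>"
    and e: "\<forall>s. \<bar>F s - F' s\<bar> \<le> e/2" "\<forall>s. \<bar>G s - G' s\<bar> \<le> e/2"
    using assms unfolding unif_approx_def by (meson half_gt_zero)
  have "\<bar>F s + G s - (F' s + G' s)\<bar> \<le> e" for s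
    using e[THEN spec, of s] by linarith
  then show "\<exists>K\<in>lin_comb \<Phi>. \<forall>s. \<bar>F s + G s - K s\<bar> \<le> e"
    by (intro bexI[OF _ lin_comb.add[OF FG]]) simp
qed

lemma unif_approx_limit:
  assumes "\<And>e. e > 0 \<Longrightarrow> \<exists>G. unif_approx \<Phi> G \<and> (\<forall>s. \<bar>F s - G s\<bar> \<le> e)"
  shows "unif_approx \<Phi> F"
  unfolding unif_approx_def
proof (intro allI impI)
  fix e :: real assume e: "e > 0"
  then obtain G where G: "unif_approx \<Phi> G" "\<forall>s. \<bar>F s - G s\<bar> \<le> e/2"
    using assms by (meson half_gt_zero)
  then obtain K where K: "K \<in> lin_comb \<Phi>" "\<forall>s. \<bar>G s - K s\<bar> \<le> e/2"
    using e unfolding unif_approx_def by (meson half_gt_zero)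
  have "\<bar>F s - K s\<bar> \<le> e" for s
    using G(2)[rule_format, of s] K(2)[rule_format, of s] by linarith
  then show "\<exists>K\<in>lin_comb \<Phi>. \<forall>s. \<bar>F s - K s\<bar> \<le> e"
    using K(1) by blast
qed

locale mult_closed =
  fixes \<Phi> :: "('c \<Rightarrow> real) set"
  assumes gen_one: "(\<lambda>_. 1) \<in> \<Phi>"
    and gen_mult: "U \<in> \<Phi> \<Longrightarrow> V \<in> \<Phi> \<Longrightarrow> (\<lambda>s. U s * V s) \<in> \<Phi>"
    and gen_bound: "U \<in> \<Phi> \<Longrightarrow> \<bar>U s\<bar> \<le> 1"
begin

lemma lin_comb_const: "(\<lambda>_. c) \<in> lin_comb \<Phi>"
  using lin_comb.gen[OF gen_one, of c] by simp

lemma lin_comb_bounded: "F \<in> lin_comb \<Phi> \<Longrightarrow> \<exists>B. \<forall>s. \<bar>F s\<bar> \<le> B"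
proof (induction rule: lin_comb.induct)
  case (gen U c)
  have "\<bar>c * U s\<bar> \<le> \<bar>c\<bar>" for s
    using gen_bound[OF gen, of s] by (simp add: abs_mult mult_left_le)
  then show ?case by blast
next
  case (add F G)
  then obtain A B where "\<forall>s. \<bar>F s\<bar> \<le> A" "\<forall>s. \<bar>G s\<bar> \<le> B" by blast
  then have "\<bar>F s + G s\<bar> \<le> A + B" for s
    by (meson abs_triangle_ineq add_mono order_trans)
  then show ?case by blast
qed

lemma lin_comb_scaled_gen_mult:
  assumes "F \<in> lin_comb \<Phi>" "U \<in> \<Phi>"
  shows "(\<lambda>s. c * U s * F s) \<in> lin_comb \<Phi>"
  using assms(1)
proof (induction rule: lin_comb.induct)
  case (gen V c')
  then show ?case
    using lin_comb.gen[OF gen_mult[OF assms(2) gen], of "c * c'"] by (simp add: ac_simps)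
next
  case (add F G)
  then show ?case
    using lin_comb.add[OF add.IH] by (simp add: algebra_simps)
qed

lemma lin_comb_mult:
  assumes "F \<in> lin_comb \<Phi>" "G \<in> lin_comb \<Phi>"
  shows "(\<lambda>s. F s * G s) \<in> lin_comb \<Phi>"
  using assms(1)
proof (induction rule: lin_comb.induct)
  case (gen U c)
  then show ?case using lin_comb_scaled_gen_mult[OF assms(2)] by blast
next
  case (add F' F'')
  then show ?case using lin_comb.add[OF add.IH] by (simp add: algebra_simps)
qed

lemma unif_approx_bounded:
  assumes "unif_approx \<Phi> F"
  obtains B where "B > 0" "\<And>s. \<bar>F s\<bar> \<le> B"
proof -
  obtain G where G: "G \<in> lin_comb \<Phi>" "\<forall>s. \<bar>F s - G s\<bar> \<le> 1"
    using assms unfolding unif_approx_def using zero_less_one by blast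
  obtain B where B: "\<forall>s. \<bar>G s\<bar> \<le> B"
    using lin_comb_bounded[OF G(1)] by blast
  have "\<bar>F s\<bar> \<le> \<bar>B\<bar> + 1" for s
    using G(2)[rule_format, of s] B[rule_format, of s] by linarith
  then show thesis using that[of "\<bar>B\<bar> + 1"] by simp
qed

lemma unif_approx_mult:
  assumes "unif_approx \<Phi> F" "unif_approx \<Phi> G"
  shows "unif_approx \<Phi> (\<lambda>s. F s * G s)"
  unfolding unif_approx_def
proof (intro allI impI)
  fix e :: real assume e: "e > 0"
  obtain A where A: "A > 0" "\<And>s. \<bar>F s\<bar> \<le> A" using unif_approx_bounded[OF assms(1)] by blast
  obtain B where B: "B > 0" "\<And>s. \<bar>G s\<bar> \<le> B" using unif_approx_bounded[OF assms(2)] by blast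
  \<comment> \<open>The error of the product is at most
    \<open>\<delta> * B + (A + 1) * \<delta>\<close>; the minimum with 1 is what bounds the
    approximant \<open>F'\<close> by \<open>A + 1\<close>.\<close>
  define \<delta> where "\<delta> = min 1 (e / (A + 1 + B))"
  have \<delta>: "\<delta> > 0" "\<delta> \<le> 1" "\<delta> * (A + 1 + B) \<le> e"
  proof -
    show "\<delta> > 0" "\<delta> \<le> 1"
      using e A B by (auto simp: \<delta>_def)
    have "\<delta> \<le> e / (A + 1 + B)" by (simp add: \<delta>_def)
    then show "\<delta> * (A + 1 + B) \<le> e"
      using A B by (simp add: pos_le_divide_eq)
  qed
  obtain F' where F': "F' \<in> lin_comb \<Phi>" "\<forall>s. \<bar>F s - F' s\<bar> \<le> \<delta>"
    using assms(1) \<delta>(1) unfolding unif_approx_def by blast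
  obtain G' where G': "G' \<in> lin_comb \<Phi>" "\<forall>s. \<bar>G s - G' s\<bar> \<le> \<delta>"
    using assms(2) \<delta>(1) unfolding unif_approx_def by blast
  have "\<bar>F s * G s - F' s * G' s\<bar> \<le> e" for s
  proof -
    have F's: "\<bar>F' s\<bar> \<le> A + 1"
      using F'(2)[rule_format, of s] A(2)[of s] \<delta>(2) by linarith
    have "F s * G s - F' s * G' s = (F s - F' s) * G s + F' s * (G s - G' s)"
      by (simp add: algebra_simps)
    then have "\<bar>F s * G s - F' s * G' s\<bar> \<le> \<bar>F s - F' s\<bar> * \<bar>G s\<bar> + \<bar>F' s\<bar> * \<bar>G s - G' s\<bar>"
      by (metis abs_mult abs_triangle_ineq)
    also have "\<dots> \<le> \<delta> * B + (A + 1) * \<delta>"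
      using F' G' F's B A \<delta> by (intro add_mono mult_mono) auto
    also have "\<dots> \<le> e"
      using \<delta>(3) by (simp add: algebra_simps)
    finally show ?thesis .
  qed
  then show "\<exists>K\<in>lin_comb \<Phi>. \<forall>s. \<bar>F s * G s - K s\<bar> \<le> e"
    by (intro bexI[OF _ lin_comb_mult[OF F'(1) G'(1)]]) simp
qed

lemma unif_approx_polynomial:
  assumes "real_polynomial_function (p :: real \<Rightarrow> real)" and F: "unif_approx \<Phi> F"
  shows "unif_approx \<Phi> (\<lambda>s. p (F s))"
  using assms(1)
proof (induction rule: real_polynomial_function.induct)
  case (linear f)
  have "f = (\<lambda>u. f 1 * u)"
    using bounded_linear.linear[OF linear] by (metis mult.commute linear_cmul mult.right_neutral real_scaleR_def)
  then have "(\<lambda>s. f (F s)) = (\<lambda>s. f 1 * F s)" by metis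
  then show ?case
    using unif_approx_mult[OF unif_approx_lin_comb[OF lin_comb_const] F] by simp
next
  case (const c)
  then show ?case by (rule unif_approx_lin_comb[OF lin_comb_const])
next
  case (add f g)
  then show ?case by (intro unif_approx_add)
next
  case (mult f g)
  then show ?case by (intro unif_approx_mult)
qed

text \<open>Approximable functionals are bounded, so a continuous \<open>h\<close> has to be
  approximated only on a compact interval. Weierstrass polynomials in an approximable functional are
  approximable because the linear span of a multiplicative family is an algebra.\<close>

lemma unif_approx_cont_algebra:
  "F \<in> cont_algebra \<Phi> \<Longrightarrow> unif_approx \<Phi> F"
proof (induction rule: cont_algebra.induct)
  case (gen U)
  then show ?case
    using unif_approx_lin_comb[OF lin_comb.gen[OF gen, of 1]] by simp
next
  case (mult F G)
  then show ?case by (intro unif_approx_mult)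
next
  case (comp F h)
  show ?case
  proof (rule unif_approx_limit)
    fix e :: real assume e: "e > 0"
    obtain B where B: "\<And>s. \<bar>F s\<bar> \<le> B"
      using unif_approx_bounded[OF comp.IH] by blast
    have "compact {-B..B}" "continuous_on {-B..B} h"
      using comp.hyps by (auto intro: continuous_on_subset)
    then obtain p where p: "real_polynomial_function p" "\<And>u. u \<in> {-B..B} \<Longrightarrow> \<bar>h u - p u\<bar> < e"
      using Stone_Weierstrass_real_polynomial_function[OF _ _ e] by metis
    have "F s \<in> {-B..B}" for s
      using B[of s] by (auto simp: abs_le_iff)
    then have "\<bar>h (F s) - p (F s)\<bar> \<le> e" for s
      using p(2)[of "F s"] by force
    then show "\<exists>G. unif_approx \<Phi> G \<and> (\<forall>s. \<bar>h (F s) - G s\<bar> \<le> e)"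
      using unif_approx_polynomial[OF p(1) comp.IH] by blast
  qed
qed

lemma cont_algebra_prod:
  assumes "\<And>i. i \<in> I \<Longrightarrow> F i \<in> cont_algebra \<Phi>"
  shows "(\<lambda>s. \<Prod>i\<in>I. F i s) \<in> cont_algebra \<Phi>"
  using assms
  by (induction I rule: infinite_finite_induct) (auto intro: cont_algebra.intros gen_one)

end

section \<open>Limits of expectations and a portmanteau bound\<close>

lemma integral_diff_le:
  assumes "prob_space Q" "integrable Q F" "integrable Q G" "\<And>\<omega>. \<bar>F \<omega> - G \<omega>\<bar> \<le> (e :: real)"
  shows "\<bar>integral\<^sup>L Q F - integral\<^sup>L Q G\<bar> \<le> e"
proof -
  interpret Q: prob_space Q by fact
  have "\<bar>integral\<^sup>L Q F - integral\<^sup>L Q G\<bar> = \<bar>integral\<^sup>L Q (\<lambda>\<omega>. F \<omega> - G \<omega>)\<bar>"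
    using assms by simp
  also have "\<dots> \<le> integral\<^sup>L Q (\<lambda>\<omega>. \<bar>F \<omega> - G \<omega>\<bar>)"
    by (rule integral_abs_bound)
  also have "\<dots> \<le> integral\<^sup>L Q (\<lambda>_. e)"
    using assms by (intro integral_mono) auto
  finally show ?thesis by (simp add: Q.prob_space)
qed

text \<open>No sigma-algebra is put on the configurations: only the composed real functionals have
  to be measurable, and along the sequence only eventually, as in
  \<open>conv_in_law\<close>.\<close>

locale functional_convergence = mult_closed \<Phi>
  for \<Phi> :: "('c \<Rightarrow> real) set" +
  fixes PN :: "nat \<Rightarrow> 'w measure" and SN :: "nat \<Rightarrow> 'w \<Rightarrow> 'c"
    and P :: "'v measure" and S :: "'v \<Rightarrow> 'c"
  assumes prob_PN: "\<And>N. prob_space (PN N)" and prob_P: "prob_space P"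
    and gen_measurable_PN:
      "U \<in> \<Phi> \<Longrightarrow> \<forall>\<^sub>F N in sequentially. (\<lambda>\<omega>. U (SN N \<omega>)) \<in> borel_measurable (PN N)"
    and gen_measurable_P: "U \<in> \<Phi> \<Longrightarrow> (\<lambda>\<omega>. U (S \<omega>)) \<in> borel_measurable P"
    and gen_expectation: "U \<in> \<Phi> \<Longrightarrow>
      (\<lambda>N. integral\<^sup>L (PN N) (\<lambda>\<omega>. U (SN N \<omega>))) \<longlonglongrightarrow> integral\<^sup>L P (\<lambda>\<omega>. U (S \<omega>))"
begin

lemma lin_comb_measurable_PN:
  "F \<in> lin_comb \<Phi> \<Longrightarrow> \<forall>\<^sub>F N in sequentially. (\<lambda>\<omega>. F (SN N \<omega>)) \<in> borel_measurable (PN N)"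
proof (induction rule: lin_comb.induct)
  case (gen U c)
  from gen_measurable_PN[OF this] show ?case by eventually_elim simp
next
  case (add F G)
  from add.IH show ?case by eventually_elim simp
qed

lemma lin_comb_measurable_P:
  "F \<in> lin_comb \<Phi> \<Longrightarrow> (\<lambda>\<omega>. F (S \<omega>)) \<in> borel_measurable P"
  by (induction rule: lin_comb.induct) (auto intro: gen_measurable_P borel_measurable_times)

lemma cont_algebra_measurable_PN:
  "F \<in> cont_algebra \<Phi> \<Longrightarrow> \<forall>\<^sub>F N in sequentially. (\<lambda>\<omega>. F (SN N \<omega>)) \<in> borel_measurable (PN N)"
proof (induction rule: cont_algebra.induct)
  case (gen U)
  then show ?case by (rule gen_measurable_PN)
next
  case (mult F G)
  from mult.IH show ?case by eventually_elim simp
next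
  case (comp F h)
  from comp.IH show ?case
    by eventually_elim (rule borel_measurable_continuous_on[OF comp.hyps(2)])
qed

lemma cont_algebra_measurable_P:
  "F \<in> cont_algebra \<Phi> \<Longrightarrow> (\<lambda>\<omega>. F (S \<omega>)) \<in> borel_measurable P"
  by (induction rule: cont_algebra.induct)
    (auto intro: gen_measurable_P borel_measurable_continuous_on)

lemma bounded_integrable_PN:
  assumes "(\<lambda>\<omega>. F (SN N \<omega>)) \<in> borel_measurable (PN N)" "\<And>s. \<bar>F s\<bar> \<le> (B :: real)"
  shows "integrable (PN N) (\<lambda>\<omega>. F (SN N \<omega>))"
  using assms
  by (intro finite_measure.integrable_const_bound[OF prob_space.finite_measure[OF prob_PN], where B = B]) auto

lemma bounded_integrable_P:
  assumes "(\<lambda>\<omega>. F (S \<omega>)) \<in> borel_measurable P" "\<And>s. \<bar>F s\<bar> \<le> (B :: real)"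
  shows "integrable P (\<lambda>\<omega>. F (S \<omega>))"
  using assms
  by (intro finite_measure.integrable_const_bound[OF prob_space.finite_measure[OF prob_P], where B = B]) auto

lemma lin_comb_expectation:
  "F \<in> lin_comb \<Phi> \<Longrightarrow>
    (\<lambda>N. integral\<^sup>L (PN N) (\<lambda>\<omega>. F (SN N \<omega>))) \<longlonglongrightarrow> integral\<^sup>L P (\<lambda>\<omega>. F (S \<omega>))"
proof (induction rule: lin_comb.induct)
  case (gen U c)
  then show ?case using tendsto_mult[OF tendsto_const[of c] gen_expectation[OF gen]] by simp
next
  case (add F G)
  obtain A B where AB: "\<And>s. \<bar>F s\<bar> \<le> A" "\<And>s. \<bar>G s\<bar> \<le> B"
    using lin_comb_bounded add.hyps by meson
  have P: "integral\<^sup>L P (\<lambda>\<omega>. F (S \<omega>) + G (S \<omega>)) = integral\<^sup>L P (\<lambda>\<omega>. F (S \<omega>)) + integral\<^sup>L P (\<lambda>\<omega>. G (S \<omega>))"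
    using AB add.hyps by (intro Bochner_Integration.integral_add bounded_integrable_P lin_comb_measurable_P)
  have PN: "\<forall>\<^sub>F N in sequentially. integral\<^sup>L (PN N) (\<lambda>\<omega>. F (SN N \<omega>)) + integral\<^sup>L (PN N) (\<lambda>\<omega>. G (SN N \<omega>))
      = integral\<^sup>L (PN N) (\<lambda>\<omega>. F (SN N \<omega>) + G (SN N \<omega>))"
    using lin_comb_measurable_PN[OF add.hyps(1)] lin_comb_measurable_PN[OF add.hyps(2)]
  proof eventually_elim
    case (elim N)
    then show ?case
      using AB by (intro Bochner_Integration.integral_add[symmetric] bounded_integrable_PN)
  qed
  show ?case
    unfolding P by (rule Lim_transform_eventually[OF tendsto_add[OF add.IH] PN])
qed

lemma cont_algebra_expectation:
  assumes F: "F \<in> cont_algebra \<Phi>"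
  shows "(\<lambda>N. integral\<^sup>L (PN N) (\<lambda>\<omega>. F (SN N \<omega>))) \<longlonglongrightarrow> integral\<^sup>L P (\<lambda>\<omega>. F (S \<omega>))"
proof (rule tendstoI)
  fix e :: real assume e: "e > 0"
  obtain G where G: "G \<in> lin_comb \<Phi>" "\<And>s. \<bar>F s - G s\<bar> \<le> e/4"
    using unif_approx_cont_algebra[OF F] e unfolding unif_approx_def
    by (metis zero_less_divide_iff zero_less_numeral)
  obtain A where A: "\<And>s. \<bar>F s\<bar> \<le> A"
    using unif_approx_bounded[OF unif_approx_cont_algebra[OF F]] by blast
  obtain B where B: "\<And>s. \<bar>G s\<bar> \<le> B"
    using lin_comb_bounded[OF G(1)] by blast
  have P: "\<bar>integral\<^sup>L P (\<lambda>\<omega>. F (S \<omega>)) - integral\<^sup>L P (\<lambda>\<omega>. G (S \<omega>))\<bar> \<le> e/4"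
    using A B F G
    by (intro integral_diff_le prob_P bounded_integrable_P cont_algebra_measurable_P lin_comb_measurable_P)
  have "\<forall>\<^sub>F N in sequentially.
      dist (integral\<^sup>L (PN N) (\<lambda>\<omega>. G (SN N \<omega>))) (integral\<^sup>L P (\<lambda>\<omega>. G (S \<omega>))) < e/4"
    using tendstoD[OF lin_comb_expectation[OF G(1)], of "e/4"] e by simp
  then show "\<forall>\<^sub>F N in sequentially.
      dist (integral\<^sup>L (PN N) (\<lambda>\<omega>. F (SN N \<omega>))) (integral\<^sup>L P (\<lambda>\<omega>. F (S \<omega>))) < e"
    using cont_algebra_measurable_PN[OF F] lin_comb_measurable_PN[OF G(1)]
  proof eventually_elim
    case (elim N)
    have "\<bar>integral\<^sup>L (PN N) (\<lambda>\<omega>. F (SN N \<omega>)) - integral\<^sup>L (PN N) (\<lambda>\<omega>. G (SN N \<omega>))\<bar> \<le> e/4"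
      using A B G elim
      by (intro integral_diff_le prob_PN bounded_integrable_PN)
    then show ?case
      using elim(1) P e unfolding dist_real_def by linarith
  qed
qed

text \<open>The open-set half of the portmanteau theorem, with \<open>A\<close> in the role of an
  open set: almost surely on \<open>A\<close> some \<open>G i\<close> equals 1, and each
  \<open>G i\<close> is eventually supported in \<open>AN N\<close>. The index from which
  \<open>forces\<close> holds depends on \<open>i\<close>, so only finitely many \<open>G i\<close>
  are used at a time.\<close>

lemma measure_liminf_lower_bound:
  assumes A: "A \<in> sets P" and AN: "\<And>N. AN N \<in> sets (PN N)"
    and G: "\<And>i::nat. G i \<in> cont_algebra \<Phi>" "\<And>i s. 0 \<le> G i s" "\<And>i s. G i s \<le> 1"
    and forces: "\<And>i. \<forall>\<^sub>F N in sequentially. \<forall>\<omega>\<in>space (PN N). G i (SN N \<omega>) > 0 \<longrightarrow> \<omega> \<in> AN N"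
    and cover: "AE \<omega> in P. \<omega> \<in> A \<longrightarrow> (\<exists>i. G i (S \<omega>) = 1)"
    and e: "e > 0"
  shows "\<forall>\<^sub>F N in sequentially. measure (PN N) (AN N) > measure P A - e"
proof -
  interpret P: prob_space P by (rule prob_P)
  \<comment> \<open>A soft union: 0 where all the \<open>G i\<close> vanish, and 1 as soon as one of
    them is 1.\<close>
  define F where "F = (\<lambda>m s. 1 - (\<Prod>i<m. 1 - G i s))"
  have Fc: "F m \<in> cont_algebra \<Phi>" for m
    unfolding F_def
    by (intro cont_algebra.comp[where h = "\<lambda>u. 1 - u"] cont_algebra_prod G continuous_intros)
  have F01: "0 \<le> F m s" "F m s \<le> 1" for m s
    using prod_le_1[of "{..<m}" "\<lambda>i. 1 - G i s"] prod_nonneg[of "{..<m}" "\<lambda>i. 1 - G i s"] G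
    by (auto simp: F_def)
  have Fabs: "\<bar>F m s\<bar> \<le> 1" for m s
    using F01 by (simp add: abs_le_iff order_trans[of "- F m s" 0])
  have F1: "F m s = 1" if "G i s = 1" "i < m" for i m s
  proof -
    have "\<exists>i\<in>{..<m}. 1 - G i s = 0"
      using that by auto
    then have "(\<Prod>i<m. 1 - G i s) = 0"
      by (simp add: prod_zero_iff)
    then show ?thesis by (simp add: F_def)
  qed
  \<comment> \<open>The indicator restricts the pointwise limit to \<open>A\<close>, since
    \<open>cover\<close> says nothing elsewhere; it is dropped again by nonnegativity of
    \<open>F m\<close>.\<close>
  have "(\<lambda>m. integral\<^sup>L P (\<lambda>\<omega>. F m (S \<omega>) * indicator A \<omega>)) \<longlonglongrightarrow> integral\<^sup>L P (indicat_real A)"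
  proof (rule integral_dominated_convergence[where w = "\<lambda>_. 1"])
    show "AE \<omega> in P. (\<lambda>m. F m (S \<omega>) * indicat_real A \<omega>) \<longlonglongrightarrow> indicat_real A \<omega>"
      using cover
    proof eventually_elim
      case (elim \<omega>)
      have "\<forall>\<^sub>F m in sequentially. indicat_real A \<omega> = F m (S \<omega>) * indicat_real A \<omega>"
      proof (cases "\<omega> \<in> A")
        case True
        then obtain i where "G i (S \<omega>) = 1" using elim by blast
        then have "F m (S \<omega>) = 1" if "m > i" for m using F1 that by blast
        then show ?thesis
          by (intro eventually_mono[OF eventually_gt_at_top[of i]]) simp
      qed simp
      then show ?case
        by (rule Lim_transform_eventually[OF tendsto_const])
    qed
    show "AE \<omega> in P. norm (F m (S \<omega>) * indicat_real A \<omega>) \<le> 1" for m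
      using Fabs by (auto simp: indicator_def)
  qed (use A cont_algebra_measurable_P[OF Fc] in \<open>auto intro!: borel_measurable_times\<close>)
  then have "(\<lambda>m. integral\<^sup>L P (\<lambda>\<omega>. F m (S \<omega>) * indicator A \<omega>)) \<longlonglongrightarrow> measure P A"
    using A by simp
  then have "\<forall>\<^sub>F m in sequentially. integral\<^sup>L P (\<lambda>\<omega>. F m (S \<omega>) * indicator A \<omega>) > measure P A - e/2"
    using e by (intro order_tendstoD) auto
  then obtain m where m: "integral\<^sup>L P (\<lambda>\<omega>. F m (S \<omega>) * indicator A \<omega>) > measure P A - e/2"
    by (meson eventually_happens' sequentially_bot)
  have int: "integrable P (\<lambda>\<omega>. F m (S \<omega>))"
    by (rule bounded_integrable_P[OF cont_algebra_measurable_P[OF Fc] Fabs])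
  have "integral\<^sup>L P (\<lambda>\<omega>. F m (S \<omega>) * indicator A \<omega>) \<le> integral\<^sup>L P (\<lambda>\<omega>. F m (S \<omega>))"
    using F01 int A by (intro integral_mono integrable_mult_indicator integrable_real_mult_indicator)
      (auto simp: indicator_def)
  with m have "\<forall>\<^sub>F N in sequentially. integral\<^sup>L (PN N) (\<lambda>\<omega>. F m (SN N \<omega>)) > measure P A - e"
    using e by (intro order_tendstoD(1)[OF cont_algebra_expectation[OF Fc]]) auto
  moreover have "\<forall>\<^sub>F N in sequentially. \<forall>i\<in>{..<m}. \<forall>\<omega>\<in>space (PN N). G i (SN N \<omega>) > 0 \<longrightarrow> \<omega> \<in> AN N"
    by (intro eventually_ball_finite ballI forces) simp
  ultimately show ?thesis
    using cont_algebra_measurable_PN[OF Fc[of m]]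
  proof eventually_elim
    case (elim N)
    interpret PN: prob_space "PN N" by (rule prob_PN)
    have "F m (SN N \<omega>) \<le> indicat_real (AN N) \<omega>" if "\<omega> \<in> space (PN N)" for \<omega>
    proof (cases "\<omega> \<in> AN N")
      case True
      then show ?thesis using F01 by simp
    next
      case False
      then have "G i (SN N \<omega>) = 0" if "i < m" for i
        using elim(2) \<open>\<omega> \<in> space (PN N)\<close> that G(2)[of i "SN N \<omega>"] by force
      then show ?thesis by (simp add: F_def)
    qed
    then have "integral\<^sup>L (PN N) (\<lambda>\<omega>. F m (SN N \<omega>)) \<le> integral\<^sup>L (PN N) (indicat_real (AN N))"
      using AN bounded_integrable_PN[OF elim(3) Fabs]
      by (intro integral_mono) (auto simp: less_top[symmetric])
    then show ?case
      using elim(1) AN by simp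
  qed
qed

end

subsection \<open>Discretization and measurability\<close>

lemma proper_mspace_dense_sequence:
  assumes "proper_mspace X d" "x \<in> X"
  obtains e :: "nat \<Rightarrow> 'a" where "range e \<subseteq> X" "\<And>y r. y \<in> X \<Longrightarrow> r > 0 \<Longrightarrow> \<exists>i. d y (e i) < r"
proof -
  interpret Metric_space X d using assms by (simp add: proper_mspace_def)
  have tb: "mtotally_bounded (mcball x r)" for r
    using assms compactin_imp_mtotally_bounded unfolding proper_mspace_def by blast
  then have "\<forall>n m. \<exists>K. finite K \<and> K \<subseteq> mcball x (real n) \<and>
      mcball x (real n) \<subseteq> (\<Union>y\<in>K. mball y (1 / real (Suc m)))"
    unfolding mtotally_bounded_def by simp
  then obtain K where K: "\<And>n m. finite (K n m)" "\<And>n m. K n m \<subseteq> mcball x (real n)"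
    "\<And>n m. mcball x (real n) \<subseteq> (\<Union>y\<in>K n m. mball y (1 / real (Suc m)))"
    by metis
  \<comment> \<open>Compact balls have finite nets at every scale. Inserting \<open>x\<close> makes
    the set visibly nonempty, as the enumeration by \<open>from_nat_into\<close> requires.\<close>
  define D where "D = insert x (\<Union>n m. K n m)"
  have "K n m \<subseteq> X" for n m
    using K(2)[of n m] mcball_subset_mspace by blast
  then have D: "D \<subseteq> X" "D \<noteq> {}"
    using assms unfolding D_def by auto
  have cD: "countable D"
    using countable_finite[OF K(1)] unfolding D_def by (intro countable_insert countable_UN) simp_all
  have dense: "\<exists>t\<in>D. d y t < r" if y: "y \<in> X" and r: "r > 0" for y r
  proof -
    obtain n where n: "d x y \<le> real n" using real_arch_simple by blast
    obtain m where m: "1 / real (Suc m) < r"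
      using r nat_approx_posE by blast
    have "y \<in> mcball x (real n)" using n y assms by simp
    then obtain t where "t \<in> K n m" "y \<in> mball t (1 / real (Suc m))" using K(3) by blast
    then have "t \<in> D" "d y t < r"
      using m by (auto simp: D_def commute)
    then show ?thesis by blast
  qed
  show thesis
  proof (rule that[of "from_nat_into D"])
    show "range (from_nat_into D) \<subseteq> X" using D cD by (simp add: range_from_nat_into)
    show "\<exists>i. d y (from_nat_into D i) < r" if "y \<in> X" "r > 0" for y r
      using dense[OF that] cD by (metis from_nat_into_to_nat_on)
  qed
qed

text \<open>The least index chooses one cell per point, so the space is cut into countably many
  disjoint cells and a finite configuration turns into a finite set of naturals.\<close>

definition approx_index :: "('a \<Rightarrow> 'a \<Rightarrow> real) \<Rightarrow> (nat \<Rightarrow> 'a) \<Rightarrow> real \<Rightarrow> 'a \<Rightarrow> nat" where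
  "approx_index d e r y = (LEAST i. d y (e i) < r)"

text \<open>Scales are taken from a sequence rather than from all positive reals to keep the
  patterns countable.\<close>

definition mesh :: "nat \<Rightarrow> real" where
  "mesh m = 1 / real (Suc m)"

lemma mesh_pos [simp]: "0 < mesh m"
  by (simp add: mesh_def)

lemma mesh_le_1: "mesh m \<le> 1"
  by (simp add: mesh_def)

lemma eventually_mesh_less:
  assumes "(c :: real) > 0"
  shows "\<forall>\<^sub>F m in sequentially. a * mesh m < c"
proof -
  have "(\<lambda>m. a * mesh m) \<longlonglongrightarrow> a * 0"
    unfolding mesh_def by (intro tendsto_mult tendsto_const LIMSEQ_Suc lim_1_over_n)
  then show ?thesis
    using assms by (intro order_tendstoD) auto
qed

locale dense_sequence = Metric_space M d for M :: "'a set" and d +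
  fixes e :: "nat \<Rightarrow> 'a"
  assumes e_in [simp]: "e i \<in> M"
    and dense: "y \<in> M \<Longrightarrow> r > 0 \<Longrightarrow> \<exists>i. d y (e i) < r"
begin

lemma approx_index_close:
  assumes "y \<in> M" "r > 0"
  shows "d y (e (approx_index d e r y)) < r"
  unfolding approx_index_def using dense[OF assms] by (rule LeastI_ex)

lemma approx_index_dist:
  assumes "y \<in> M" "z \<in> M" "r > 0"
  shows "\<bar>d (e (approx_index d e r y)) (e (approx_index d e r z)) - d y z\<bar> < 2 * r"
proof -
  let ?y = "e (approx_index d e r y)" and ?z = "e (approx_index d e r z)"
  have "d y ?y < r" "d z ?z < r"
    using assms approx_index_close by blast+
  moreover have "d ?y ?z \<le> d y ?y + d y z + d z ?z"
    using triangle[of ?y y ?z] triangle[of y z ?z] assms by (simp add: commute)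
  moreover have "d y z \<le> d y ?y + d ?y ?z + d z ?z"
    using triangle[of y ?y z] triangle[of ?y ?z z] assms by (simp add: commute)
  ultimately show ?thesis by linarith
qed

text \<open>The least index is \<open>i\<close> exactly on the ball around \<open>e i\<close> minus
  the finitely many earlier balls.\<close>

lemma approx_index_vimage_borel:
  assumes "B \<in> mborel_sets M d" "r > 0"
  shows "{y \<in> B. approx_index d e r y = i} \<in> mborel_sets M d"
proof -
  have op: "{U. openin mtopology U} \<subseteq> Pow M"
    using openin_subset by force
  interpret sigma_algebra M "mborel_sets M d"
    unfolding mborel_sets_def using op by (rule sigma_algebra_sigma_sets)
  have "mball (e j) r \<in> mborel_sets M d" for j
    unfolding mborel_sets_def by (intro sigma_sets.Basic) simp
  then have "B \<inter> (mball (e i) r - (\<Union>j<i. mball (e j) r)) \<in> mborel_sets M d"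
    using assms by (intro Int Diff finite_UN) auto
  moreover have "{y \<in> B. approx_index d e r y = i} = B \<inter> (mball (e i) r - (\<Union>j<i. mball (e j) r))"
  proof -
    have BM: "B \<subseteq> M" using assms(1) sets_into_space by blast
    have "approx_index d e r y = i \<longleftrightarrow> d y (e i) < r \<and> (\<forall>j<i. \<not> d y (e j) < r)" if "y \<in> M" for y
    proof
      assume "approx_index d e r y = i"
      then show "d y (e i) < r \<and> (\<forall>j<i. \<not> d y (e j) < r)"
        using approx_index_close[OF that assms(2)] not_less_Least unfolding approx_index_def by blast
    next
      assume "d y (e i) < r \<and> (\<forall>j<i. \<not> d y (e j) < r)"
      then show "approx_index d e r y = i"
        unfolding approx_index_def by (intro Least_equality) (auto simp: not_less[symmetric])
    qed
    then have "y \<in> B \<and> approx_index d e r y = i \<longleftrightarrow> y \<in> B \<inter> (mball (e i) r - (\<Union>j<i. mball (e j) r))" for y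
      using BM e_in by (cases "y \<in> B") (auto simp: commute subset_iff)
    then show ?thesis by blast
  qed
  ultimately show ?thesis by simp
qed

text \<open>Enlarging the threshold by twice the mesh keeps the closed condition \<open>d y z \<le> L\<close> after
  discretization.\<close>
lemma eventually_rball_iso_discretize:
  assumes x: "x \<in> M" and S: "S \<subseteq> M" and fin: "finite (S \<inter> mcball x (real k * L))" and L: "L \<ge> 0"
  shows "\<forall>\<^sub>F m in sequentially. rball_iso (geom_edge d x S L) x
    (geom_edge (\<lambda>i j. d (e i) (e j)) (approx_index d e (mesh m) x)
       (approx_index d e (mesh m) ` (S \<inter> mcball x (real k * L))) (L + 2 * mesh m))
    (approx_index d e (mesh m) x) k"
proof -
  define V where "V = insert x (S \<inter> mcball x (real k * L))"
  have V: "finite V" "V \<subseteq> M" "x \<in> V" "V \<subseteq> insert x S" using assms by (auto simp: V_def)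
  have "{y \<in> insert x S. d x y \<le> real k * L} \<subseteq> V"
    using S x by (auto simp: V_def)
  then have gV: "gball (geom_edge d x S L) x k \<subseteq> V"
    using gball_geom_edge_subset[OF x S L, of k] by (rule subset_trans[rotated])
  \<comment> \<open>Rounding changes a distance by less than \<open>2 * mesh m\<close>. The first
    condition therefore keeps distinct points distinct; the second absorbs this error together with
    the enlargement of the threshold by \<open>2 * mesh m\<close>.\<close>
  have "\<forall>\<^sub>F m in sequentially. \<forall>y\<in>V. \<forall>z\<in>V.
      (y \<noteq> z \<longrightarrow> 2 * mesh m < d y z) \<and> (L < d y z \<longrightarrow> 4 * mesh m < d y z - L)"
  proof (intro eventually_ball_finite V ballI eventually_conj)
    fix y z assume "y \<in> V" "z \<in> V"
    then have "d y z > 0" if "y \<noteq> z"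
      using that V by (metis nonneg order_le_less subsetD zero)
    then show "\<forall>\<^sub>F m in sequentially. y \<noteq> z \<longrightarrow> 2 * mesh m < d y z"
      using eventually_mesh_less[of "d y z" 2] by (cases "y = z") auto
    show "\<forall>\<^sub>F m in sequentially. L < d y z \<longrightarrow> 4 * mesh m < d y z - L"
      using eventually_mesh_less[of "d y z - L" 4] by (cases "L < d y z") auto
  qed
  then show ?thesis
  proof eventually_elim
    case (elim m)
    let ?c = "approx_index d e (mesh m)"
    have ad: "\<bar>d (e (?c y)) (e (?c z)) - d y z\<bar> < 2 * mesh m" if "y \<in> V" "z \<in> V" for y z
      using approx_index_dist[of y z "mesh m"] that V by auto
    have inj: "inj_on ?c V"
    proof (rule inj_onI, rule ccontr)
      fix y z assume yz: "y \<in> V" "z \<in> V" "?c y = ?c z" "y \<noteq> z"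
      have "d (e (?c y)) (e (?c z)) = 0" using yz by simp
      then show False using ad[OF yz(1,2)] elim yz by fastforce
    qed
    show ?case
    proof (rule rball_isoI[OF inj])
      show "gball (geom_edge d x S L) x k \<subseteq> V" by (rule gV)
      show "gball (geom_edge (\<lambda>i j. d (e i) (e j)) (?c x) (?c ` (S \<inter> mcball x (real k * L)))
              (L + 2 * mesh m)) (?c x) k \<subseteq> ?c ` V"
        unfolding V_def image_insert by (rule gball_geom_edge_vertices)
      fix y z assume y: "y \<in> gball (geom_edge d x S L) x k" and z: "z \<in> V"
      then have yV: "y \<in> V" using gV by blast
      have "d y z \<le> L \<longleftrightarrow> d (e (?c y)) (e (?c z)) \<le> L + 2 * mesh m"
      proof
        assume "d y z \<le> L"
        then show "d (e (?c y)) (e (?c z)) \<le> L + 2 * mesh m"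
          using ad[OF yV z] by linarith
      next
        assume a: "d (e (?c y)) (e (?c z)) \<le> L + 2 * mesh m"
        show "d y z \<le> L"
        proof (rule ccontr)
          assume "\<not> d y z \<le> L"
          then have "4 * mesh m < d y z - L" using elim yV z by simp
          then show False using a ad[OF yV z] by linarith
        qed
      qed
      moreover have "?c y = ?c z \<longleftrightarrow> y = z"
        using inj yV z by (meson inj_on_eq_iff)
      moreover have "?c y \<in> insert (?c x) (?c ` (S \<inter> mcball x (real k * L)))"
          "?c z \<in> insert (?c x) (?c ` (S \<inter> mcball x (real k * L)))"
        using yV z by (auto simp: V_def)
      moreover have "y \<in> insert x S" "z \<in> insert x S"
        using yV z V by auto
      ultimately show "geom_edge d x S L y z \<longleftrightarrow> geom_edge (\<lambda>i j. d (e i) (e j)) (?c x)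
          (?c ` (S \<inter> mcball x (real k * L))) (L + 2 * mesh m) (?c y) (?c z)"
        unfolding geom_edge_def by simp
    qed simp
  qed
qed

end

text \<open>For each outcome the rounded graph eventually has the same ball as the original one, so
  the event is a limit of events about the rounded configuration. The latter takes countably many
  values, each described by counts in Borel cells.\<close>

lemma simple_point_process_rball_iso_sets:
  fixes X :: "'a set" and M :: "'w \<Rightarrow> 'a set"
  assumes X: "proper_mspace X d" "x \<in> X" and M: "simple_point_process P X d M" and L: "L \<ge> 0"
  shows "{\<omega> \<in> space P. rball_iso (geom_edge d x (M \<omega>) L) x H h0 k} \<in> sets P"
proof -
  obtain e :: "nat \<Rightarrow> 'a" where e: "range e \<subseteq> X" "\<And>y r. y \<in> X \<Longrightarrow> r > 0 \<Longrightarrow> \<exists>i. d y (e i) < r"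
    using proper_mspace_dense_sequence[OF X] by blast
  interpret Metric_space X d using X by (simp add: proper_mspace_def)
  interpret dense_sequence X d e
    using e by unfold_locales auto
  define B where "B = mcball x (real k * L)"
  define c where "c m = approx_index d e (mesh m)" for m
  define T where "T m \<omega> = c m ` (M \<omega> \<inter> B)" for m \<omega>
  define Q where "Q m T \<longleftrightarrow> rball_iso (geom_edge (\<lambda>i j. d (e i) (e j)) (c m x) T (L + 2 * mesh m))
    (c m x) H h0 k" for m T
  have MX: "M \<omega> \<subseteq> X" "finite (M \<omega> \<inter> B)" if "\<omega> \<in> space P" for \<omega>
    using M that X unfolding simple_point_process_def B_def by auto
  have B: "B \<in> mborel_sets X d"
  proof -
    have "X - (X - B) \<in> mborel_sets X d"
      unfolding mborel_sets_def
    proof (rule sigma_sets.Compl, rule sigma_sets.Basic, rule CollectI)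
      show "openin mtopology (X - B)"
        using closedin_mcball[of x "real k * L"] by (simp add: B_def closedin_def)
    qed
    moreover have "X - (X - B) = B" by (auto simp: B_def)
    ultimately show ?thesis by simp
  qed
  have cell: "{\<omega> \<in> space P. i \<in> T m \<omega>} \<in> sets P" for m i
  proof -
    let ?C = "{y \<in> B. c m y = i}"
    have "?C \<in> mborel_sets X d"
      unfolding c_def using B by (rule approx_index_vimage_borel) simp
    moreover have "mbounded ?C"
      unfolding mbounded_def B_def by blast
    ultimately have "(\<lambda>\<omega>. card (M \<omega> \<inter> ?C)) \<in> measurable P (count_space UNIV)"
      using M unfolding simple_point_process_def by blast
    then have "{\<omega> \<in> space P. card (M \<omega> \<inter> ?C) \<noteq> 0} \<in> sets P"
      by measurable
    moreover have "{\<omega> \<in> space P. card (M \<omega> \<inter> ?C) \<noteq> 0} = {\<omega> \<in> space P. i \<in> T m \<omega>}"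
    proof (intro Collect_cong conj_cong refl)
      fix \<omega> assume "\<omega> \<in> space P"
      \<comment> \<open>An infinite set has \<open>card\<close> 0, so only finiteness lets a nonzero
        count detect an atom in the cell.\<close>
      then have "finite (M \<omega> \<inter> ?C)"
        using finite_subset[OF _ MX(2)[of \<omega>], of "M \<omega> \<inter> ?C"] by auto
      then show "card (M \<omega> \<inter> ?C) \<noteq> 0 \<longleftrightarrow> i \<in> T m \<omega>"
        by (auto simp: T_def card_eq_0_iff)
    qed
    ultimately show ?thesis by simp
  qed
  have Q: "{\<omega> \<in> space P. Q m (T m \<omega>)} \<in> sets P" for m
  proof -
    have *: "{\<omega> \<in> space P. T m \<omega> = A} \<in> sets P" for A
    proof -
      have "{\<omega> \<in> space P. \<forall>i. i \<in> T m \<omega> \<longleftrightarrow> i \<in> A} \<in> sets P"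
        using cell[of _ m] by (intro sets.sets_Collect_countable_All sets.sets_Collect) simp_all
      then show ?thesis by (simp add: set_eq_iff)
    qed
    have "{\<omega> \<in> space P. Q m (T m \<omega>)} = (\<Union>A\<in>{A. finite A \<and> Q m A}. {\<omega> \<in> space P. T m \<omega> = A})"
      using MX(2) by (auto simp: T_def)
    moreover have "countable {A :: nat set. finite A \<and> Q m A}"
      by (rule countable_subset[OF _ countable_Collect_finite]) auto
    ultimately show ?thesis
      using * by (auto intro!: sets.countable_UN')
  qed
  have "{\<omega> \<in> space P. rball_iso (geom_edge d x (M \<omega>) L) x H h0 k} =
      {\<omega> \<in> space P. \<forall>\<^sub>F m in sequentially. Q m (T m \<omega>)}"
  proof (intro Collect_cong conj_cong refl)
    fix \<omega> assume \<omega>: "\<omega> \<in> space P"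
    \<comment> \<open>The right-hand side does not depend on \<open>m\<close>, so it coincides with
      the eventual truth of \<open>Q m (T m \<omega>)\<close>.\<close>
    have "\<forall>\<^sub>F m in sequentially. Q m (T m \<omega>) \<longleftrightarrow> rball_iso (geom_edge d x (M \<omega>) L) x H h0 k"
      using eventually_rball_iso_discretize[OF X(2) MX(1)[OF \<omega>] MX(2)[OF \<omega>, unfolded B_def] L]
    proof eventually_elim
      case (elim m)
      show ?case
        unfolding Q_def T_def c_def B_def by (rule rball_iso_cong[OF elim, symmetric])
    qed
    from eventually_subst[OF this]
    show "rball_iso (geom_edge d x (M \<omega>) L) x H h0 k \<longleftrightarrow> (\<forall>\<^sub>F m in sequentially. Q m (T m \<omega>))"
      by simp
  qed
  then show ?thesis
    using sets_Collect_eventually_sequentially[of P "\<lambda>\<omega> m. Q m (T m \<omega>)"] Q by simp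
qed

subsection \<open>Stability of rooted balls under small perturbations\<close>

text \<open>At distance exactly \<open>L\<close>, any smaller threshold would delete the edge
  between \<open>y\<close> and \<open>z\<close>; but nested isomorphic finite balls have the same
  edges. Continuity is used at radius \<open>Suc k\<close> because \<open>z\<close> may lie one step
  beyond the ball of radius \<open>k\<close>.\<close>

lemma (in Metric_space) no_pair_at_exact_distance:
  assumes x: "x \<in> M" and S: "S \<subseteq> M" and fin: "finite (S \<inter> mcball x (real (Suc k) * L))" and L: "L > 0"
    and reg: "\<delta> > 0" "\<And>l. \<bar>l - L\<bar> < \<delta> \<Longrightarrow>
      rball_iso (geom_edge d x S l) x (geom_edge d x S L) x (Suc k)"
    and y: "y \<in> gball (geom_edge d x S L) x k" and z: "z \<in> insert x S"
  shows "d y z \<noteq> L"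
proof
  assume yz: "d y z = L"
  let ?E = "geom_edge d x S"
  define l where "l = L - \<delta> / 2"
  have y': "y \<in> insert x S"
    using gball_geom_edge_vertices y by (rule subsetD)
  have "y \<noteq> z"
  proof
    assume "y = z"
    then have "d y z = 0" using y' x S by (metis insertE mdist_zero subsetD)
    then show False using yz L by simp
  qed
  then have E: "?E L y z"
    using y' z yz by (simp add: geom_edge_def)
  have "{y \<in> insert x S. d x y \<le> real (Suc k) * L} \<subseteq> insert x (S \<inter> mcball x (real (Suc k) * L))"
    using S x by auto
  then have "gball (?E L) x (Suc k) \<subseteq> insert x (S \<inter> mcball x (real (Suc k) * L))"
    using gball_geom_edge_subset[OF x S less_imp_le[OF L], of "Suc k"] by (rule subset_trans[rotated])
  then have fin': "finite (gball (?E L) x (Suc k))"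
    by (rule finite_subset) (rule finite.insertI[OF fin])
  have iso: "rball_iso (?E l) x (?E L) x (Suc k)"
    by (rule reg(2)) (use reg(1) in \<open>simp add: l_def\<close>)
  have "?E l y z"
  proof (rule rball_iso_subgraph_imp_eq[OF _ fin' iso _ _ E])
    show "?E L u v" if "?E l u v" for u v
      using that reg(1) by (simp add: geom_edge_def l_def)
    show "y \<in> gball (?E L) x (Suc k)" using y by simp
    show "z \<in> gball (?E L) x (Suc k)" unfolding gball.simps using y E by blast
  qed
  then show False
    using yz reg(1) by (simp add: geom_edge_def l_def)
qed

text \<open>Every atom of \<open>V\<close> is matched with an atom of \<open>S'\<close> nearby, and
  the cap on the number of atoms shows that no atom relevant for the ball remains unmatched.
  Matching moves distances by less than the margins \<open>sep\<close> and \<open>gap\<close>, so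
  vertices stay distinct and adjacency is preserved.\<close>

lemma (in dense_sequence) perturbed_rball_iso:
  fixes d' :: "'b \<Rightarrow> 'b \<Rightarrow> real" and f :: "'b \<Rightarrow> 'a"
  assumes x: "x \<in> M" "S \<subseteq> M" "x \<notin> S" and L: "L > 0"
    and V: "V = S \<inter> mcball x (real k * L)" "finite V"
    and \<epsilon>: "\<epsilon> > 0"
    and sep: "\<And>y z. y \<in> insert x V \<Longrightarrow> z \<in> insert x V \<Longrightarrow> y \<noteq> z \<Longrightarrow> 8 * \<epsilon> < d y z"
    and gap: "\<And>y z. y \<in> insert x V \<Longrightarrow> z \<in> insert x V \<Longrightarrow> d y z \<noteq> L \<Longrightarrow> 8 * \<epsilon> < \<bar>d y z - L\<bar>"
    and exact: "\<And>y z. y \<in> gball (geom_edge d x S L) x k \<Longrightarrow> z \<in> insert x S \<Longrightarrow> d y z \<noteq> L"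
    and X': "Metric_space X' d'" "x' \<in> X'" "S' \<subseteq> X'"
    and B': "B' = Metric_space.mcball X' d' x' R" "real k * L \<le> R" "finite (S' \<inter> B')"
    and f: "f ` B' \<subseteq> M" "inj_on f B'" "d x (f x') \<le> \<epsilon>"
      "\<And>y z. y \<in> B' \<Longrightarrow> z \<in> B' \<Longrightarrow> \<bar>d (f y) (f z) - d' y z\<bar> \<le> \<epsilon>"
    and T: "T = approx_index d e \<epsilon> ` V"
    and hit: "\<And>i. i \<in> T \<Longrightarrow> \<exists>b\<in>f ` (S' \<inter> B'). d (e i) b < 2 * \<epsilon>"
    and few: "card {b \<in> f ` (S' \<inter> B'). d x b \<le> real k * L + 3 * \<epsilon>} \<le> card T"
  shows "rball_iso (geom_edge d' x' S' L) x' (geom_edge d x S L) x k"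
proof -
  interpret X': Metric_space X' d' by (rule X')
  have VM: "V \<subseteq> M" "V \<subseteq> S" "x \<notin> V" using V x by auto
  have R: "0 \<le> real k * L" "0 \<le> R"
    using L B'(2) by (auto intro: order_trans[rotated])
  have x'B: "x' \<in> B'" using X' R B' by simp
  \<comment> \<open>Rounding \<open>a\<close> costs \<open>\<epsilon>\<close> and the atom found by
    \<open>hit\<close> is within \<open>2 * \<epsilon>\<close> of the rounded point.\<close>
  have "\<exists>v\<in>S' \<inter> B'. d a (f v) \<le> 3 * \<epsilon>" if a: "a \<in> V" for a
  proof -
    let ?i = "approx_index d e \<epsilon> a"
    obtain v where v: "v \<in> S' \<inter> B'" "d (e ?i) (f v) < 2 * \<epsilon>"
      using hit[of ?i] T a by blast
    have "d a (e ?i) < \<epsilon>" using approx_index_close VM a \<epsilon> by blast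
    moreover have "f v \<in> M" using f v by blast
    ultimately have "d a (f v) \<le> 3 * \<epsilon>"
      using v triangle[of a "e ?i" "f v"] VM a by force
    then show ?thesis using v by blast
  qed
  then obtain w where w: "\<And>a. a \<in> V \<Longrightarrow> w a \<in> S' \<inter> B' \<and> d a (f (w a)) \<le> 3 * \<epsilon>"
    by metis
  define h where "h a = (if a = x then x' else w a)" for a
  have hV: "h a \<in> S' \<inter> B'" "d a (f (h a)) \<le> 3 * \<epsilon>" if "a \<in> V" for a
    using w[OF that] VM that by (auto simp: h_def)
  have hx: "h x = x'" by (simp add: h_def)
  have hi: "h a \<in> B'" "a \<in> M" "f (h a) \<in> M" "d a (f (h a)) \<le> 3 * \<epsilon>" if "a \<in> insert x V" for a
    using that hV hx x'B f(1,3) \<epsilon> VM x by auto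
  \<comment> \<open>Each endpoint contributes \<open>3 * \<epsilon>\<close> and the map
    \<open>f\<close> another \<open>\<epsilon>\<close>: at most \<open>7 * \<epsilon>\<close> in
    total, below the margin 8.\<close>
  have close: "\<bar>d' (h y) (h z) - d y z\<bar> < 8 * \<epsilon>" if "y \<in> insert x V" "z \<in> insert x V" for y z
  proof -
    note y = hi[OF that(1)] and z = hi[OF that(2)]
    have "d (f (h y)) (f (h z)) \<le> d y (f (h y)) + d y z + d z (f (h z))"
      using triangle[of "f (h y)" y "f (h z)"] triangle[of y z "f (h z)"] y z by (simp add: commute)
    moreover have "d y z \<le> d y (f (h y)) + d (f (h y)) (f (h z)) + d z (f (h z))"
      using triangle[of y "f (h y)" z] triangle[of "f (h y)" "f (h z)" z] y z by (simp add: commute)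
    ultimately show ?thesis
      using f(4)[OF y(1) z(1)] y z \<epsilon> by linarith
  qed
  have injh: "inj_on h (insert x V)"
  proof (rule inj_onI, rule ccontr)
    fix y z assume yz: "y \<in> insert x V" "z \<in> insert x V" "h y = h z" "y \<noteq> z"
    have "h y \<in> X'" using hi(1)[OF yz(1)] B' by simp
    then have "d' (h y) (h z) = 0" using yz by simp
    then show False using close[OF yz(1,2)] sep[OF yz(1,2,4)] by linarith
  qed
  let ?N = "{b \<in> f ` (S' \<inter> B'). d x b \<le> real k * L + 3 * \<epsilon>}"
  \<comment> \<open>The left side consists of \<open>card V\<close> distinct points of
    \<open>?N\<close>, while \<open>few\<close> allows at most \<open>card T\<close>, which is at
    most \<open>card V\<close>.\<close>
  have N: "f ` h ` V = ?N"
  proof (rule card_subset_eq)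
    show "finite ?N" using B' by simp
    show sub: "f ` h ` V \<subseteq> ?N"
    proof clarify
      fix a assume a: "a \<in> V"
      have "d x a \<le> real k * L" using a V by simp
      then have "d x (f (h a)) \<le> real k * L + 3 * \<epsilon>"
        using triangle[of x a "f (h a)"] hi[of a] a x by auto
      then show "f (h a) \<in> f ` (S' \<inter> B') \<and> d x (f (h a)) \<le> real k * L + 3 * \<epsilon>"
        using hV[OF a] by blast
    qed
    have "inj_on f (h ` V)"
      using hV by (intro inj_on_subset[OF f(2)]) auto
    then have "card (f ` h ` V) = card V"
      using injh by (simp add: card_image inj_on_insert)
    moreover have "card T \<le> card V"
      unfolding T using V by (intro card_image_le) simp
    ultimately show "card (f ` h ` V) = card ?N"
      using few card_mono[OF \<open>finite ?N\<close> sub] by linarith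
  qed
  have "{y \<in> insert x S. d x y \<le> real k * L} \<subseteq> insert x V"
    using V x by auto
  then have gV: "gball (geom_edge d x S L) x k \<subseteq> insert x V"
    using gball_geom_edge_subset[OF x(1,2) less_imp_le[OF L], of k] by (rule subset_trans[rotated])
  have "rball_iso (geom_edge d x S L) x (geom_edge d' x' S' L) x' k"
  proof (rule rball_isoI[OF injh hx gV])
    show "gball (geom_edge d' x' S' L) x' k \<subseteq> h ` insert x V"
    proof
      fix v assume "v \<in> gball (geom_edge d' x' S' L) x' k"
      then have v: "v \<in> insert x' S'" "d' x' v \<le> real k * L"
        using X'.gball_geom_edge_subset[OF X'(2,3) less_imp_le[OF L], of k] by auto
      show "v \<in> h ` insert x V"
      proof (cases "v = x'")
        case True
        then show ?thesis using hx by auto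
      next
        case False
        then have vB: "v \<in> S' \<inter> B'" using v B' X' by auto
        \<comment> \<open>The root is displaced by at most \<open>\<epsilon>\<close> and
          \<open>f\<close> distorts by at most \<open>\<epsilon>\<close>, so the image of a ball
          vertex stays in the region controlled by the cap.\<close>
        have "d x (f v) \<le> d x (f x') + d (f x') (f v)"
          using triangle[of x "f x'" "f v"] x f(1) x'B vB by blast
        then have "d x (f v) \<le> real k * L + 3 * \<epsilon>"
          using f(3) f(4)[OF x'B, of v] vB v \<epsilon> by auto
        then have "f v \<in> f ` h ` V" using N vB by blast
        then obtain a where a: "a \<in> V" "f v = f (h a)" by blast
        then have "v = h a"
          using f(2) hV vB by (meson IntD2 inj_onD)
        then show ?thesis using a by blast
      qed
    qed
    fix y z assume y: "y \<in> gball (geom_edge d x S L) x k" and z: "z \<in> insert x V"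
    have yV: "y \<in> insert x V" using y gV by blast
    \<comment> \<open>The margin \<open>gap\<close> is available only away from the value
      \<open>L\<close>; this is where regularity enters.\<close>
    have "d y z \<noteq> L" using exact[OF y] z VM by blast
    then have "d y z \<le> L \<longleftrightarrow> d' (h y) (h z) \<le> L"
      using gap[OF yV z] close[OF yV z] by linarith
    moreover have "h y = h z \<longleftrightarrow> y = z" using injh yV z by (meson inj_on_eq_iff)
    moreover have "y \<in> insert x S" "z \<in> insert x S" "h y \<in> insert x' S'" "h z \<in> insert x' S'"
      using yV z VM hV hx by auto
    ultimately show "geom_edge d x S L y z \<longleftrightarrow> geom_edge d' x' S' L (h y) (h z)"
      unfolding geom_edge_def by simp
  qed
  then show ?thesis by (rule rball_iso_sym)
qed

subsection \<open>Dilations close to one\<close>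

lemma dil_upper_bound:
  assumes "Metric_space X d" "A \<subseteq> X" "bdd_above (dil_set A d d' f)" "y \<in> A" "z \<in> A"
    and "d' (f y) (f y) = 0"
  shows "d' (f y) (f z) \<le> dil A d d' f * d y z"
proof (cases "y = z")
  case True
  interpret Metric_space X d by fact
  have "d y z = 0" using True assms by auto
  then show ?thesis using True assms by simp
next
  case False
  interpret Metric_space X d by fact
  have m: "d' (f y) (f z) / d y z \<in> dil_set A d d' f"
    unfolding dil_set_def using assms False by blast
  then have "d' (f y) (f z) / d y z \<le> dil A d d' f"
    using assms(3) unfolding dil_def by (auto intro: cSup_upper)
  moreover have "d y z > 0"
    using False assms by (metis nonneg order_le_less subsetD zero)
  ultimately show ?thesis by (simp add: pos_divide_le_eq)
qed

text \<open>Prepares for logarithms: a small \<open>ln D\<close> bounds \<open>D\<close> only once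
  \<open>D > 0\<close>. An injective map has a positive quotient at any two distinct points, and the
  convention 1 settles the one-point domain.\<close>

lemma dil_pos:
  assumes "Metric_space X d" "A \<subseteq> X" "Metric_space X' d'" "f ` A \<subseteq> X'" "inj_on f A"
    and bdd: "bdd_above (dil_set A d d' f)"
  shows "dil A d d' f > 0"
proof (cases "dil_set A d d' f = {}")
  case True
  then show ?thesis by (simp add: dil_def)
next
  case False
  interpret Metric_space X d by fact
  interpret X': Metric_space X' d' by fact
  obtain y z where yz: "y \<in> A" "z \<in> A" "y \<noteq> z"
    using False unfolding dil_set_def by blast
  have "d y z > 0"
    using yz assms(2) by (metis nonneg order_le_less subsetD zero)
  moreover have "f y \<noteq> f z" "f y \<in> X'" "f z \<in> X'"
    using yz assms(4,5) by (auto dest: inj_onD)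
  then have "d' (f y) (f z) > 0"
    by (metis X'.nonneg order_le_less X'.zero)
  ultimately have "0 < d' (f y) (f z) / d y z" by simp
  also have "\<dots> \<le> dil A d d' f"
  proof -
    have "d' (f y) (f z) / d y z \<in> dil_set A d d' f"
      unfolding dil_set_def using yz by blast
    then show ?thesis
      using bdd unfolding dil_def by (auto intro: cSup_upper)
  qed
  finally show ?thesis .
qed

text \<open>Points of a ball of radius \<open>R\<close> are at most \<open>2 * R\<close> apart, so a
  dilation of at most \<open>1 + e / (2 * R)\<close> costs an additive error of at most
  \<open>e\<close>. Applying this to \<open>g\<close> at \<open>f y\<close> and \<open>f z\<close>
  gives the opposite estimate.\<close>

lemma near_isometry:
  fixes f :: "'a \<Rightarrow> 'b" and g :: "'b \<Rightarrow> 'a"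
  assumes XN: "Metric_space X' d'" "x' \<in> X'" and X: "Metric_space X d" "x \<in> X"
    and B': "B' = Metric_space.mcball X' d' x' R" and B: "B = Metric_space.mcball X d x R"
    and hom: "homeomorphic_maps (subtopology (Metric_space.mtopology X' d') B')
       (subtopology (Metric_space.mtopology X d) B) f g"
    and bdd: "bdd_above (dil_set B' d' d f)" "bdd_above (dil_set B d d' g)"
    and R: "R > 0" and e: "e > 0"
    and ln: "\<bar>ln (dil B' d' d f)\<bar> < ln (1 + e / (2 * R))" "\<bar>ln (dil B d d' g)\<bar> < ln (1 + e / (2 * R))"
  shows "f ` B' \<subseteq> B" "inj_on f B'" "\<And>y z. y \<in> B' \<Longrightarrow> z \<in> B' \<Longrightarrow> \<bar>d (f y) (f z) - d' y z\<bar> \<le> e"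
proof -
  interpret X: Metric_space X d by fact
  interpret X': Metric_space X' d' by fact
  have BX: "B \<subseteq> X" "B' \<subseteq> X'" using B B' X.mcball_subset_mspace X'.mcball_subset_mspace by auto
  have top: "topspace (subtopology X'.mtopology B') = B'" "topspace (subtopology X.mtopology B) = B"
    using BX by auto
  show fB: "f ` B' \<subseteq> B"
    using hom top continuous_map_image_subset_topspace unfolding homeomorphic_maps_def by metis
  have gB: "g ` B \<subseteq> B'"
    using hom top continuous_map_image_subset_topspace unfolding homeomorphic_maps_def by metis
  have gf: "g (f y) = y" if "y \<in> B'" for y
    using hom top that unfolding homeomorphic_maps_def by simp
  have fg: "f (g y) = y" if "y \<in> B" for y
    using hom top that unfolding homeomorphic_maps_def by simp
  show inj: "inj_on f B'" using gf by (rule inj_on_inverseI)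
  have injg: "inj_on g B" using fg by (rule inj_on_inverseI)
  define \<eta> where "\<eta> = e / (2 * R)"
  have \<eta>: "\<eta> > 0" "\<eta> * (2 * R) = e" using e R by (auto simp: \<eta>_def)
  have le: "D \<le> 1 + \<eta>" if "D > 0" "\<bar>ln D\<bar> < ln (1 + \<eta>)" for D :: real
  proof -
    have "ln D < ln (1 + \<eta>)" using that by linarith
    then show ?thesis using that \<eta> by simp
  qed
  have df: "dil B' d' d f \<le> 1 + \<eta>"
    using le[OF dil_pos[OF XN(1) BX(2) X(1) _ inj bdd(1)]] ln(1) fB BX by (auto simp: \<eta>_def)
  have dg: "dil B d d' g \<le> 1 + \<eta>"
    using le[OF dil_pos[OF X(1) BX(1) XN(1) _ injg bdd(2)]] ln(2) gB BX by (auto simp: \<eta>_def)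
  have diam: "d u v \<le> 2 * R" if "u \<in> B" "v \<in> B" for u v
    using that X.triangle[of u x v] by (auto simp: B X.commute)
  have diam': "d' u v \<le> 2 * R" if "u \<in> B'" "v \<in> B'" for u v
    using that X'.triangle[of u x' v] by (auto simp: B' X'.commute)
  fix y z assume y: "y \<in> B'" and z: "z \<in> B'"
  have fyz: "f y \<in> B" "f z \<in> B" using fB y z by auto
  have "d (f y) (f z) \<le> dil B' d' d f * d' y z"
    using fyz BX by (intro dil_upper_bound[OF XN(1) BX(2) bdd(1) y z]) auto
  also have "\<dots> \<le> (1 + \<eta>) * d' y z"
    using df by (intro mult_right_mono) auto
  also have "\<dots> \<le> d' y z + e"
    using mult_left_mono[OF diam'[OF y z] less_imp_le[OF \<eta>(1)]] \<eta>(2) by (simp add: algebra_simps)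
  finally have 1: "d (f y) (f z) \<le> d' y z + e" .
  have "d' (g (f y)) (g (f z)) \<le> dil B d d' g * d (f y) (f z)"
    using gf[OF y] y BX by (intro dil_upper_bound[OF X(1) BX(1) bdd(2) fyz]) auto
  also have "\<dots> \<le> (1 + \<eta>) * d (f y) (f z)"
    using dg by (intro mult_right_mono) auto
  also have "\<dots> \<le> d (f y) (f z) + e"
    using mult_left_mono[OF diam[OF fyz] less_imp_le[OF \<eta>(1)]] \<eta>(2) by (simp add: algebra_simps)
  finally have "d' y z \<le> d (f y) (f z) + e" using gf y z by simp
  with 1 show "\<bar>d (f y) (f z) - d' y z\<bar> \<le> e" by linarith
qed

subsection \<open>Pattern functionals\<close>

text \<open>A continuous substitute for the indicator of the closed ball of radius \<open>s\<close>
  around \<open>c\<close>, decreasing linearly to 0 over a further width \<open>r\<close>.\<close>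

definition cutoff :: "('b \<Rightarrow> 'b \<Rightarrow> real) \<Rightarrow> 'b \<Rightarrow> real \<Rightarrow> real \<Rightarrow> 'b \<Rightarrow> real" where
  "cutoff d c s r y = max 0 (min 1 (1 + (s - d c y) / r))"

lemma cutoff_nonneg: "0 \<le> cutoff d c s r y" and cutoff_le_1: "cutoff d c s r y \<le> 1"
  by (auto simp: cutoff_def)

lemma cutoff_eq_1: "r > 0 \<Longrightarrow> d c y \<le> s \<Longrightarrow> cutoff d c s r y = 1"
  by (auto simp: cutoff_def)

lemma cutoff_eq_0:
  assumes "r > 0" "d c y \<ge> s + r"
  shows "cutoff d c s r y = 0"
proof -
  have "(s - d c y) / r \<le> -1" using assms by (simp add: pos_divide_le_eq)
  then show ?thesis by (simp add: cutoff_def)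
qed

lemma (in Metric_space) continuous_map_cutoff:
  assumes c: "c \<in> M"
  shows "continuous_map mtopology euclideanreal (cutoff d c s r)"
proof -
  have "continuous_map mtopology euclideanreal (d c)"
    unfolding continuous_map_from_metric
  proof (intro conjI ballI allI impI)
    fix a U assume a: "a \<in> M" and U: "openin euclideanreal U \<and> d c a \<in> U"
    then obtain \<epsilon> where \<epsilon>: "\<epsilon> > 0" "\<And>t. dist t (d c a) < \<epsilon> \<Longrightarrow> t \<in> U"
      unfolding open_openin[symmetric] open_dist by blast
    have "d c y \<in> U" if "y \<in> M" "d a y < \<epsilon>" for y
    proof (rule \<epsilon>(2))
      show "dist (d c y) (d c a) < \<epsilon>"
        using triangle[of c a y] triangle[of c y a] that a c commute[of a y] by (simp add: dist_real_def)
    qed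
    then show "\<exists>r>0. \<forall>y. y \<in> M \<and> d a y < r \<longrightarrow> d c y \<in> U" using \<epsilon>(1) by blast
  qed simp
  moreover have "continuous_map euclideanreal euclideanreal (\<lambda>t. max 0 (min 1 (1 + (s - t) / r)))"
    unfolding continuous_map_iff_continuous2 divide_inverse by (intro continuous_intros)
  ultimately show ?thesis
    unfolding cutoff_def[abs_def] by (rule continuous_map_compose[unfolded comp_def])
qed

lemma cc_in_ball_cutoff:
  assumes X: "proper_mspace X d" "x \<in> X" "c \<in> X" and r: "r > 0" and R: "d x c + s + r < R"
  shows "cc_in_ball X d x R (cutoff d c s r)"
proof -
  interpret Metric_space X d using X by (simp add: proper_mspace_def)
  show ?thesis
    unfolding cc_in_ball_def
  proof (intro conjI exI[of _ "mcball c (s + r)"] continuous_map_cutoff X(3))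
    show "compactin mtopology (mcball c (s + r))"
      using X by (simp add: proper_mspace_def)
    show "mcball c (s + r) \<subseteq> mball x R"
    proof
      fix y assume "y \<in> mcball c (s + r)"
      then show "y \<in> mball x R"
        using triangle[of x c y] X R by simp
    qed
    show "\<forall>y\<in>X - mcball c (s + r). cutoff d c s r y = 0"
      using X r by (auto intro!: cutoff_eq_0)
  qed
qed

section \<open>Laplace functionals and soft counting\<close>

definition laplace :: "('b \<Rightarrow> real) \<Rightarrow> 'b set \<Rightarrow> real" where
  "laplace \<phi> S = exp (- (\<Sum>a\<in>S. \<phi> a))"

definition laplace_functionals :: "'b set \<Rightarrow> ('b \<Rightarrow> 'b \<Rightarrow> real) \<Rightarrow> 'b \<Rightarrow> real \<Rightarrow> ('b set \<Rightarrow> real) set" where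
  "laplace_functionals X d x R = {laplace \<phi> |\<phi>. cc_in_ball X d x R \<phi> \<and> (\<forall>y. 0 \<le> \<phi> y)}"

lemma cc_in_ball_zero: "cc_in_ball X d x R (\<lambda>_. 0)"
  unfolding cc_in_ball_def by (intro conjI exI[of _ "{}"]) auto

lemma cc_in_ball_add:
  assumes "cc_in_ball X d x R \<phi>" "cc_in_ball X d x R \<psi>"
  shows "cc_in_ball X d x R (\<lambda>y. \<phi> y + \<psi> y)"
proof -
  obtain K K' where
    "compactin (Metric_space.mtopology X d) K" "K \<subseteq> Metric_space.mball X d x R" "\<forall>y\<in>X - K. \<phi> y = 0"
    "compactin (Metric_space.mtopology X d) K'" "K' \<subseteq> Metric_space.mball X d x R" "\<forall>y\<in>X - K'. \<psi> y = 0"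
    using assms unfolding cc_in_ball_def by metis
  then have "compactin (Metric_space.mtopology X d) (K \<union> K') \<and> K \<union> K' \<subseteq> Metric_space.mball X d x R \<and>
      (\<forall>y\<in>X - (K \<union> K'). \<phi> y + \<psi> y = 0)"
    by (auto intro: compactin_Un)
  moreover have "continuous_map (Metric_space.mtopology X d) euclideanreal (\<lambda>y. \<phi> y + \<psi> y)"
    using assms unfolding cc_in_ball_def by (intro continuous_map_add) auto
  ultimately show ?thesis
    unfolding cc_in_ball_def by blast
qed

text \<open>The exponential turns sums of test functions into products. On an infinite configuration
  every sum is 0 by convention, so the identities and the bound hold for all sets.\<close>

lemma mult_closed_laplace_functionals: "mult_closed (laplace_functionals X d x R)"
proof
  have "laplace (\<lambda>_. 0) \<in> laplace_functionals X d x R"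
    unfolding laplace_functionals_def using cc_in_ball_zero by fastforce
  then show "(\<lambda>_. 1) \<in> laplace_functionals X d x R"
    by (simp add: laplace_def[abs_def])
next
  fix U V assume "U \<in> laplace_functionals X d x R" "V \<in> laplace_functionals X d x R"
  then obtain \<phi> \<psi> where *: "U = laplace \<phi>" "cc_in_ball X d x R \<phi>" "\<forall>y. 0 \<le> \<phi> y"
      "V = laplace \<psi>" "cc_in_ball X d x R \<psi>" "\<forall>y. 0 \<le> \<psi> y"
    unfolding laplace_functionals_def by blast
  then have "(\<lambda>S. U S * V S) = laplace (\<lambda>y. \<phi> y + \<psi> y)"
    by (auto simp: laplace_def sum.distrib exp_add[symmetric])
  moreover have "laplace (\<lambda>y. \<phi> y + \<psi> y) \<in> laplace_functionals X d x R"
    unfolding laplace_functionals_def using * cc_in_ball_add[of X d x R \<phi> \<psi>] by auto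
  ultimately show "(\<lambda>S. U S * V S) \<in> laplace_functionals X d x R"
    by simp
next
  fix U S assume "U \<in> laplace_functionals X d x R"
  then show "\<bar>U S\<bar> \<le> 1"
    unfolding laplace_functionals_def by (auto simp: laplace_def sum_nonneg)
qed

text \<open>Written in the variable \<open>u = exp (- t)\<close>, where \<open>t\<close> is a soft
  count: a ramp from 0 at \<open>t = 0\<close> to 1 at \<open>t = 1\<close>.\<close>

definition hit :: "real \<Rightarrow> real" where
  "hit u = max 0 (min 1 ((1 - u) / (1 - exp (- 1))))"

text \<open>In the same variable: 1 up to soft count \<open>n\<close> and 0 from
  \<open>n + 1\<close> on.\<close>

definition few :: "nat \<Rightarrow> real \<Rightarrow> real" where
  "few n u = max 0 (min 1 ((u - exp (- real n - 1)) / (exp (- real n) - exp (- real n - 1))))"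

lemma continuous_on_hit: "continuous_on UNIV hit"
  unfolding hit_def[abs_def] divide_inverse by (intro continuous_intros)

lemma continuous_on_few: "continuous_on UNIV (few n)"
  unfolding few_def[abs_def] divide_inverse by (intro continuous_intros)

lemma hit_exp_eq_1: "t \<ge> 1 \<Longrightarrow> hit (exp (- t)) = 1"
  by (simp add: hit_def le_divide_eq)

lemma hit_exp_pos: "hit (exp (- t)) > 0 \<Longrightarrow> t > 0"
  by (rule ccontr) (auto simp: hit_def divide_le_0_iff)

lemma few_exp_eq_1: "t \<le> real n \<Longrightarrow> few n (exp (- t)) = 1"
  by (simp add: few_def le_divide_eq)

lemma few_exp_pos: "few n (exp (- t)) > 0 \<Longrightarrow> t < real n + 1"
  by (rule ccontr) (auto simp: few_def divide_le_0_iff)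

text \<open>Positive only if every point \<open>e i\<close>, \<open>i \<in> T\<close>, has an atom nearby and at most \<open>card T\<close> atoms
  are within distance \<open>K\<close> of \<open>x\<close>; so for well separated \<open>e i\<close> the atoms correspond to \<open>T\<close>.\<close>
definition pattern :: "('b \<Rightarrow> 'b \<Rightarrow> real) \<Rightarrow> 'b \<Rightarrow> (nat \<Rightarrow> 'b) \<Rightarrow> real \<Rightarrow> real \<Rightarrow> nat set \<Rightarrow> 'b set \<Rightarrow> real" where
  "pattern d x e K \<epsilon> T S =
     (\<Prod>i\<in>T. hit (laplace (cutoff d (e i) \<epsilon> \<epsilon>) S)) * few (card T) (laplace (cutoff d x (K + 3 * \<epsilon>) \<epsilon>) S)"

lemma pattern_nonneg: "0 \<le> pattern d x e K \<epsilon> T S"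
  by (auto simp: pattern_def hit_def few_def intro!: mult_nonneg_nonneg prod_nonneg)

lemma pattern_le_1: "pattern d x e K \<epsilon> T S \<le> 1"
  unfolding pattern_def
  by (intro mult_le_one prod_le_1 conjI) (auto simp: hit_def few_def intro!: prod_nonneg)

text \<open>Origin of the 5: the cutoffs around the \<open>e i\<close> reach to
  \<open>K + 3 * \<epsilon>\<close> from \<open>x\<close> and the one around \<open>x\<close> to
  \<open>K + 4 * \<epsilon>\<close>. With \<open>\<epsilon> \<le> 1\<close> all supports lie in the
  open ball of radius \<open>K + 5\<close>.\<close>

lemma pattern_in_cont_algebra:
  assumes X: "proper_mspace X d" "x \<in> X" and e: "\<And>i. e i \<in> X" and K: "K \<ge> 0" "0 < \<epsilon>" "\<epsilon> \<le> 1"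
    and T: "\<And>i. i \<in> T \<Longrightarrow> d x (e i) \<le> K + \<epsilon>"
  shows "pattern d x e K \<epsilon> T \<in> cont_algebra (laplace_functionals X d x (K + 5))"
proof -
  interpret Metric_space X d using X by (simp add: proper_mspace_def)
  interpret mult_closed "laplace_functionals X d x (K + 5)"
    by (rule mult_closed_laplace_functionals)
  have *: "laplace (cutoff d c s \<epsilon>) \<in> cont_algebra (laplace_functionals X d x (K + 5))"
    if "c \<in> X" "d x c + s + \<epsilon> < K + 5" for c s
    unfolding laplace_functionals_def
    by (intro cont_algebra.gen CollectI exI[of _ "cutoff d c s \<epsilon>"] conjI cc_in_ball_cutoff allI cutoff_nonneg refl X K that)
  have "laplace (cutoff d (e i) \<epsilon> \<epsilon>) \<in> cont_algebra (laplace_functionals X d x (K + 5))" if "i \<in> T" for i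
    using T[OF that] K e by (intro *) auto
  note hit = cont_algebra.comp[OF this continuous_on_hit]
  have "laplace (cutoff d x (K + 3 * \<epsilon>) \<epsilon>) \<in> cont_algebra (laplace_functionals X d x (K + 5))"
    using X K by (intro *) auto
  note few = cont_algebra.comp[OF this continuous_on_few]
  show ?thesis
    unfolding pattern_def[abs_def] by (rule cont_algebra.mult[OF cont_algebra_prod[OF hit] few])
qed

text \<open>The strict end of the slack: atoms within \<open>\<epsilon>\<close> of the
  \<open>e i\<close>, and the cap out to \<open>K + 4 * \<epsilon>\<close>. Positivity will return
  only \<open>2 * \<epsilon>\<close> and \<open>K + 3 * \<epsilon>\<close>, one ramp width less
  each.\<close>

lemma pattern_eq_1:
  assumes S: "finite S" and \<epsilon>: "\<epsilon> > 0" and T: "\<And>i. i \<in> T \<Longrightarrow> \<exists>a\<in>S. d (e i) a \<le> \<epsilon>"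
    and card: "card {a \<in> S. d x a < K + 4 * \<epsilon>} \<le> card T"
  shows "pattern d x e K \<epsilon> T S = 1"
proof -
  have "hit (laplace (cutoff d (e i) \<epsilon> \<epsilon>) S) = 1" if i: "i \<in> T" for i
  proof -
    obtain a where a: "a \<in> S" "d (e i) a \<le> \<epsilon>" using T[OF i] by blast
    have "1 = cutoff d (e i) \<epsilon> \<epsilon> a" using a \<epsilon> by (simp add: cutoff_eq_1)
    also have "\<dots> \<le> (\<Sum>a\<in>S. cutoff d (e i) \<epsilon> \<epsilon> a)"
      using S a by (intro member_le_sum) (auto simp: cutoff_nonneg)
    finally show ?thesis unfolding laplace_def by (rule hit_exp_eq_1)
  qed
  moreover have "few (card T) (laplace (cutoff d x (K + 3 * \<epsilon>) \<epsilon>) S) = 1"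
    unfolding laplace_def
  proof (rule few_exp_eq_1)
    let ?A = "{a \<in> S. d x a < K + 4 * \<epsilon>}"
    have "(\<Sum>a\<in>S. cutoff d x (K + 3 * \<epsilon>) \<epsilon> a) = (\<Sum>a\<in>?A. cutoff d x (K + 3 * \<epsilon>) \<epsilon> a)"
      using S \<epsilon> by (intro sum.mono_neutral_right) (auto intro!: cutoff_eq_0)
    also have "\<dots> \<le> (\<Sum>a\<in>?A. 1)"
      by (intro sum_mono cutoff_le_1)
    also have "\<dots> \<le> real (card T)" using card by simp
    finally show "(\<Sum>a\<in>S. cutoff d x (K + 3 * \<epsilon>) \<epsilon> a) \<le> real (card T)" .
  qed
  ultimately show ?thesis by (simp add: pattern_def)
qed

lemma pattern_posD:
  assumes S: "finite S" and T: "finite T" and \<epsilon>: "\<epsilon> > 0" and pos: "pattern d x e K \<epsilon> T S > 0"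
  shows "\<And>i. i \<in> T \<Longrightarrow> \<exists>b\<in>S. d (e i) b < 2 * \<epsilon>"
    and "card {b \<in> S. d x b \<le> K + 3 * \<epsilon>} \<le> card T"
proof -
  have nz: "pattern d x e K \<epsilon> T S \<noteq> 0" using pos by simp
  have hit: "hit (laplace (cutoff d (e i) \<epsilon> \<epsilon>) S) > 0" if "i \<in> T" for i
  proof -
    have "hit (laplace (cutoff d (e i) \<epsilon> \<epsilon>) S) \<noteq> 0"
      using nz T that unfolding pattern_def by (auto simp: prod_zero_iff)
    then show ?thesis by (simp add: hit_def max_def split: if_splits)
  qed
  have "few (card T) (laplace (cutoff d x (K + 3 * \<epsilon>) \<epsilon>) S) \<noteq> 0"
    using nz unfolding pattern_def by auto
  then have few: "few (card T) (laplace (cutoff d x (K + 3 * \<epsilon>) \<epsilon>) S) > 0"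
    by (simp add: few_def max_def split: if_splits)
  show "\<exists>b\<in>S. d (e i) b < 2 * \<epsilon>" if "i \<in> T" for i
  proof (rule ccontr)
    assume "\<not> (\<exists>b\<in>S. d (e i) b < 2 * \<epsilon>)"
    then have "(\<Sum>a\<in>S. cutoff d (e i) \<epsilon> \<epsilon> a) = 0"
      using \<epsilon> by (intro sum.neutral ballI cutoff_eq_0) auto
    then show False
      using hit_exp_pos hit[OF that] unfolding laplace_def by fastforce
  qed
  let ?A = "{b \<in> S. d x b \<le> K + 3 * \<epsilon>}"
  have "real (card ?A) = (\<Sum>a\<in>?A. cutoff d x (K + 3 * \<epsilon>) \<epsilon> a)"
    using \<epsilon> by (simp add: cutoff_eq_1)
  also have "\<dots> \<le> (\<Sum>a\<in>S. cutoff d x (K + 3 * \<epsilon>) \<epsilon> a)"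
    using S by (intro sum_mono2) (auto simp: cutoff_nonneg)
  also have "\<dots> < real (card T) + 1"
    using few_exp_pos few unfolding laplace_def by blast
  \<comment> \<open>A natural number strictly below \<open>card T + 1\<close> is at most
    \<open>card T\<close>, so the ramp of \<open>few\<close> loses nothing.\<close>
  finally show "card ?A \<le> card T" by linarith
qed

subsection \<open>Local convergence\<close>

text \<open>Local finiteness leaves finitely many strict inequalities, all of which survive a small
  enough mesh.\<close>

lemma (in dense_sequence) separating_mesh:
  assumes x: "x \<in> M" "S \<subseteq> M" and fin: "finite (S \<inter> mcball x (K + 5))"
  obtains m where
    "\<And>y z. y \<in> insert x (S \<inter> mcball x K) \<Longrightarrow> z \<in> insert x (S \<inter> mcball x K) \<Longrightarrow> y \<noteq> z \<Longrightarrow>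
      8 * mesh m < d y z"
    "\<And>y z. y \<in> insert x (S \<inter> mcball x K) \<Longrightarrow> z \<in> insert x (S \<inter> mcball x K) \<Longrightarrow> d y z \<noteq> L \<Longrightarrow>
      8 * mesh m < \<bar>d y z - L\<bar>"
    "\<And>a. a \<in> S \<inter> mcball x (K + 5) \<Longrightarrow> K < d x a \<Longrightarrow> K + 4 * mesh m < d x a"
proof -
  define V where "V = insert x (S \<inter> mcball x K)"
  have "S \<inter> mcball x K \<subseteq> S \<inter> mcball x (K + 5)"
    by auto
  then have V: "finite V" "V \<subseteq> M"
    using finite_subset[OF _ fin] x by (auto simp: V_def)
  have "\<forall>\<^sub>F m in sequentially.
      (\<forall>y\<in>V. \<forall>z\<in>V. (y \<noteq> z \<longrightarrow> 8 * mesh m < d y z) \<and> (d y z \<noteq> L \<longrightarrow> 8 * mesh m < \<bar>d y z - L\<bar>)) \<and>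
      (\<forall>a\<in>S \<inter> mcball x (K + 5). K < d x a \<longrightarrow> 4 * mesh m < d x a - K)"
  proof (intro eventually_conj eventually_ball_finite V ballI fin)
    fix y z assume "y \<in> V" "z \<in> V"
    then have "d y z > 0" if "y \<noteq> z"
      using that V by (metis nonneg order_le_less subsetD zero)
    then show "\<forall>\<^sub>F m in sequentially. y \<noteq> z \<longrightarrow> 8 * mesh m < d y z"
      using eventually_mesh_less[of "d y z" 8] by (cases "y = z") auto
    show "\<forall>\<^sub>F m in sequentially. d y z \<noteq> L \<longrightarrow> 8 * mesh m < \<bar>d y z - L\<bar>"
      using eventually_mesh_less[of "\<bar>d y z - L\<bar>" 8] by (cases "d y z = L") auto
  next
    fix a
    show "\<forall>\<^sub>F m in sequentially. K < d x a \<longrightarrow> 4 * mesh m < d x a - K"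
      using eventually_mesh_less[of "d x a - K" 4] by (cases "K < d x a") auto
  qed
  from eventually_happens'[OF sequentially_bot this] obtain m where
    m: "\<forall>y\<in>V. \<forall>z\<in>V. (y \<noteq> z \<longrightarrow> 8 * mesh m < d y z) \<and> (d y z \<noteq> L \<longrightarrow> 8 * mesh m < \<bar>d y z - L\<bar>)"
      "\<forall>a\<in>S \<inter> mcball x (K + 5). K < d x a \<longrightarrow> 4 * mesh m < d x a - K"
    by (elim exE conjE)
  have "8 * mesh m < d y z" if "y \<in> V" "z \<in> V" "y \<noteq> z" for y z
    using m(1)[rule_format, OF that(1,2)] that(3) by simp
  moreover have "8 * mesh m < \<bar>d y z - L\<bar>" if "y \<in> V" "z \<in> V" "d y z \<noteq> L" for y z
    using m(1)[rule_format, OF that(1,2)] that(3) by simp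
  moreover have "K + 4 * mesh m < d x a" if "a \<in> S \<inter> mcball x (K + 5)" "K < d x a" for a
    using m(2)[rule_format, OF that] by simp
  ultimately show thesis
    unfolding V_def by (rule that)
qed

text \<open>Separation makes rounding injective on \<open>V\<close>, so
  \<open>card T = card V\<close>. By \<open>shell\<close> the cutoff around \<open>x\<close> meets
  no atom outside \<open>V\<close>, hence the cap is respected.\<close>

lemma (in dense_sequence) pattern_of_separated:
  assumes x: "x \<in> M" "S \<subseteq> M" and fin: "finite (S \<inter> mcball x (K + 5))" and K: "K \<ge> 0"
    and V: "V = S \<inter> mcball x K" and T: "T = approx_index d e (mesh m) ` V"
    and sep: "\<And>y z. y \<in> insert x V \<Longrightarrow> z \<in> insert x V \<Longrightarrow> y \<noteq> z \<Longrightarrow> 8 * mesh m < d y z"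
    and shell: "\<And>a. a \<in> S \<inter> mcball x (K + 5) \<Longrightarrow> K < d x a \<Longrightarrow> K + 4 * mesh m < d x a"
  shows "finite T" "\<And>i. i \<in> T \<Longrightarrow> d x (e i) \<le> K + mesh m"
    "pattern d x e K (mesh m) T (S \<inter> mcball x (K + 5)) = 1"
proof -
  let ?c = "approx_index d e (mesh m)"
  have VS: "V \<subseteq> S \<inter> mcball x (K + 5)" "V \<subseteq> M"
    using V x by auto
  then have finV: "finite V" using fin finite_subset by blast
  then show "finite T" by (simp add: T)
  have close: "d a (e (?c a)) < mesh m" if "a \<in> V" for a
    using approx_index_close[of a "mesh m"] that VS by auto
  show "d x (e i) \<le> K + mesh m" if i: "i \<in> T" for i
  proof -
    obtain a where a: "a \<in> V" "i = ?c a" using i T by blast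
    have "d x a \<le> K" using a V by simp
    then show ?thesis
      using close[OF a(1)] triangle[of x a "e i"] a VS x by auto
  qed
  have "inj_on ?c V"
  proof (rule inj_onI, rule ccontr)
    fix y z assume yz: "y \<in> V" "z \<in> V" "?c y = ?c z" "y \<noteq> z"
    have "\<bar>d (e (?c y)) (e (?c z)) - d y z\<bar> < 2 * mesh m"
      using approx_index_dist[of y z "mesh m"] yz VS by auto
    moreover have "d (e (?c y)) (e (?c z)) = 0" using yz by simp
    ultimately show False using sep[of y z] yz mesh_pos[of m] by force
  qed
  then have card: "card T = card V" by (simp add: T card_image)
  show "pattern d x e K (mesh m) T (S \<inter> mcball x (K + 5)) = 1"
  proof (rule pattern_eq_1[OF fin])
    show "\<exists>a\<in>S \<inter> mcball x (K + 5). d (e i) a \<le> mesh m" if i: "i \<in> T" for i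
    proof -
      obtain a where a: "a \<in> V" "i = ?c a" using i T by blast
      then have "d (e i) a \<le> mesh m" using close[of a] by (simp add: commute)
      then show ?thesis using a VS by blast
    qed
    have "{a \<in> S \<inter> mcball x (K + 5). d x a < K + 4 * mesh m} \<subseteq> V"
    proof
      fix a assume a: "a \<in> {a \<in> S \<inter> mcball x (K + 5). d x a < K + 4 * mesh m}"
      then have "\<not> K < d x a" using shell[of a] by fastforce
      then show "a \<in> V" using a V by simp
    qed
    then show "card {a \<in> S \<inter> mcball x (K + 5). d x a < K + 4 * mesh m} \<le> card T"
      unfolding card by (rule card_mono[OF finV])
  qed simp
qed

theorem theorem4p11:
  fixes XN :: "nat \<Rightarrow> 'a set" and xN :: "nat \<Rightarrow> 'a" and dN :: "nat \<Rightarrow> 'a \<Rightarrow> 'a \<Rightarrow> real"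
    and PN :: "nat \<Rightarrow> 'w measure" and MN :: "nat \<Rightarrow> 'w \<Rightarrow> 'a set"
    and X :: "'b set" and x :: 'b and d :: "'b \<Rightarrow> 'b \<Rightarrow> real"
    and P :: "'v measure" and M :: "'v \<Rightarrow> 'b set"
    and L :: real
  assumes "\<And>N. proper_mspace (XN N) (dN N)" and "\<And>N. xN N \<in> XN N"
    and "proper_mspace X d" and "x \<in> X"
    and "\<And>N. prob_space (PN N)" and "prob_space P"
    and "\<And>N. simple_point_process (PN N) (XN N) (dN N) (MN N)"
    and "simple_point_process P X d M"
    and "\<And>N. AE \<omega> in PN N. xN N \<notin> MN N \<omega>"
    and "AE \<omega> in P. x \<notin> M \<omega>"
    and "random_pointed_lip_conv XN xN dN PN MN X x d P M"
    and "regular X x d P M"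
    and "L > 0"
  shows "BS_conv PN (\<lambda>N \<omega>. geom_edge (dN N) (xN N) (MN N \<omega>) L) xN
                 P (\<lambda>\<omega>. geom_edge d x (M \<omega>) L) x"
  unfolding BS_conv_def
proof (intro allI conjI)
  fix k :: nat and H :: "nat \<Rightarrow> nat \<Rightarrow> bool" and h0 :: nat
  note XN = assms(1,2) and X = assms(3,4) and prob = assms(5,6) and MN = assms(7) and M = assms(8)
    and simple_root = assms(10) and conv = assms(11) and reg = assms(12) and L = assms(13)
  define Q where "Q \<omega> \<longleftrightarrow> rball_iso (geom_edge d x (M \<omega>) L) x H h0 k" for \<omega>
  define QN where "QN N \<omega> \<longleftrightarrow> rball_iso (geom_edge (dN N) (xN N) (MN N \<omega>) L) (xN N) H h0 k" for N \<omega>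
  have setsN: "{\<omega> \<in> space (PN N). QN N \<omega>} \<in> sets (PN N)" for N
    unfolding QN_def by (rule simple_point_process_rball_iso_sets[OF XN MN less_imp_le[OF L]])
  have setsP: "{\<omega> \<in> space P. Q \<omega>} \<in> sets P"
    unfolding Q_def by (rule simple_point_process_rball_iso_sets[OF X M less_imp_le[OF L]])
  show "{\<omega> \<in> space (PN N). rball_iso (geom_edge (dN N) (xN N) (MN N \<omega>) L) (xN N) H h0 k} \<in> sets (PN N)" for N
    using setsN[of N] unfolding QN_def .
  show "{\<omega> \<in> space P. rball_iso (geom_edge d x (M \<omega>) L) x H h0 k} \<in> sets P"
    using setsP unfolding Q_def .

  have mXN: "Metric_space (XN N) (dN N)" for N using XN by (simp add: proper_mspace_def)
  interpret Metric_space X d using X by (simp add: proper_mspace_def)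
  obtain e :: "nat \<Rightarrow> 'b" where e: "range e \<subseteq> X" "\<And>y r. y \<in> X \<Longrightarrow> r > 0 \<Longrightarrow> \<exists>i. d y (e i) < r"
    using proper_mspace_dense_sequence[OF X] by blast
  interpret dense_sequence X d e
    using e by unfold_locales auto
  define K where "K = real k * L"
  define R where "R = K + 5"
  have "K \<ge> 0" using L by (simp add: K_def)
  then have K: "K \<ge> 0" "R > 0" "K \<le> R" by (simp_all add: R_def)
  define B where "B = mcball x R"
  define B' where "B' N = Metric_space.mcball (XN N) (dN N) (xN N) R" for N
  obtain N0 f g where
    maps: "\<forall>N\<ge>N0. homeomorphic_maps (subtopology (Metric_space.mtopology (XN N) (dN N)) (B' N))
             (subtopology mtopology B) (f N) (g N) \<and>
           bdd_above (dil_set (B' N) (dN N) d (f N)) \<and> bdd_above (dil_set B d (dN N) (g N))"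
    and lim: "(\<lambda>N. \<bar>ln (dil (B' N) (dN N) d (f N))\<bar> + \<bar>ln (dil B d (dN N) (g N))\<bar>
            + d (f N (xN N)) x + dN N (xN N) (g N x)) \<longlonglongrightarrow> 0"
    and law: "\<And>\<phi>. cc_in_ball X d x R \<phi> \<Longrightarrow>
           conv_in_law PN (\<lambda>N \<omega>. \<Sum>a \<in> MN N \<omega> \<inter> B' N. \<phi> (f N a)) P (\<lambda>\<omega>. \<Sum>a \<in> M \<omega> \<inter> B. \<phi> a)"
    using conv[unfolded random_pointed_lip_conv_def, rule_format, OF K(2)] unfolding B_def B'_def by blast

  have near: "\<forall>\<^sub>F N in sequentially. f N ` B' N \<subseteq> B \<and> inj_on (f N) (B' N) \<and> d x (f N (xN N)) \<le> \<epsilon> \<and>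
      (\<forall>y\<in>B' N. \<forall>z\<in>B' N. \<bar>d (f N y) (f N z) - dN N y z\<bar> \<le> \<epsilon>)" if \<epsilon>: "\<epsilon> > 0" for \<epsilon>
  proof -
    \<comment> \<open>All four terms of the limit are nonnegative, so each falls below
      \<open>\<eta>\<close>: the first bound serves the displacement of the root, the second the
      dilations.\<close>
    define \<eta> where "\<eta> = min \<epsilon> (ln (1 + \<epsilon> / (2 * R)))"
    have "1 < 1 + \<epsilon> / (2 * R)" using \<epsilon> K by simp
    then have "\<eta> > 0" using \<epsilon> unfolding \<eta>_def by (simp only: min_less_iff_conj ln_gt_zero)
    then have "\<forall>\<^sub>F N in sequentially. \<bar>ln (dil (B' N) (dN N) d (f N))\<bar> + \<bar>ln (dil B d (dN N) (g N))\<bar>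
            + d (f N (xN N)) x + dN N (xN N) (g N x) < \<eta>"
      by (rule order_tendstoD(2)[OF lim])
    then show ?thesis
      using eventually_ge_at_top[of N0]
    proof eventually_elim
      case (elim N)
      have *: "0 \<le> d (f N (xN N)) x" "0 \<le> dN N (xN N) (g N x)"
        using Metric_space.nonneg[OF mXN] by auto
      have ln: "\<bar>ln (dil (B' N) (dN N) d (f N))\<bar> < ln (1 + \<epsilon> / (2 * R))"
          "\<bar>ln (dil B d (dN N) (g N))\<bar> < ln (1 + \<epsilon> / (2 * R))" "d x (f N (xN N)) \<le> \<epsilon>"
        using elim(1) * commute[of x "f N (xN N)"] unfolding \<eta>_def min_less_iff_conj by linarith+
      note m = maps[rule_format, OF elim(2)]
      note iso = near_isometry[OF mXN XN(2) Metric_space_axioms X(2) B'_def B_def conjunct1[OF m]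
          conjunct1[OF conjunct2[OF m]] conjunct2[OF conjunct2[OF m]] K(2) \<epsilon> ln(1,2)]
      show ?case using iso ln(3) by blast
    qed
  qed

  define S where "S \<omega> = M \<omega> \<inter> B" for \<omega>
  \<comment> \<open>Pushing the atoms forward to \<open>X\<close> lets the same functionals act on
    all configurations.\<close>
  define SN where "SN N \<omega> = f N ` (MN N \<omega> \<inter> B' N)" for N \<omega>
  define \<Phi> where "\<Phi> = laplace_functionals X d x R"
  have "mult_closed \<Phi>"
    unfolding \<Phi>_def by (rule mult_closed_laplace_functionals)
  then interpret functional_convergence \<Phi> PN SN P S
  proof (intro functional_convergence.intro functional_convergence_axioms.intro prob)
    fix U assume "U \<in> \<Phi>"
    then obtain \<phi> where U: "U = laplace \<phi>" and \<phi>: "cc_in_ball X d x R \<phi>" "\<And>y. 0 \<le> \<phi> y"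
      unfolding \<Phi>_def laplace_functionals_def by blast
    let ?YN = "\<lambda>N \<omega>. \<Sum>a \<in> MN N \<omega> \<inter> B' N. \<phi> (f N a)" and ?Y = "\<lambda>\<omega>. \<Sum>a \<in> M \<omega> \<inter> B. \<phi> a"
    \<comment> \<open>Convergence in law is tested on functions bounded on the whole line;
      truncation at 0 achieves this and changes nothing on the nonnegative sums.\<close>
    let ?g = "\<lambda>t::real. exp (- max 0 t)"
    have g: "continuous_on UNIV ?g \<and> bounded (range ?g)"
      by (intro conjI continuous_intros boundedI[where B = 1]) auto
    have YN: "\<forall>\<^sub>F N in sequentially. ?YN N \<in> borel_measurable (PN N)" and Y: "?Y \<in> borel_measurable P"
      and c: "(\<lambda>N. integral\<^sup>L (PN N) (\<lambda>\<omega>. ?g (?YN N \<omega>))) \<longlonglongrightarrow> integral\<^sup>L P (\<lambda>\<omega>. ?g (?Y \<omega>))"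
      using law[OF \<phi>(1)] g unfolding conv_in_law_def by blast+
    have UY: "U (S \<omega>) = ?g (?Y \<omega>)" for \<omega>
      using \<phi>(2) by (simp add: U laplace_def S_def sum_nonneg max_def)
    have UYN: "\<forall>\<^sub>F N in sequentially. \<forall>\<omega>. U (SN N \<omega>) = ?g (?YN N \<omega>)"
      \<comment> \<open>Any positive tolerance would do: only injectivity of \<open>f N\<close> is
        used, to reindex the sum over the image.\<close>
      using near[OF zero_less_one]
    proof eventually_elim
      case (elim N)
      have "(\<Sum>b\<in>SN N \<omega>. \<phi> b) = ?YN N \<omega>" for \<omega>
        unfolding SN_def using elim by (subst sum.reindex) (auto intro: inj_on_subset)
      then show ?case
        using \<phi>(2) by (simp add: U laplace_def sum_nonneg max_def)
    qed
    have gm: "?g \<in> borel_measurable borel"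
      using g by (intro borel_measurable_continuous_onI) simp
    show "\<forall>\<^sub>F N in sequentially. (\<lambda>\<omega>. U (SN N \<omega>)) \<in> borel_measurable (PN N)"
      using UYN YN
    proof eventually_elim
      case (elim N)
      then show ?case using measurable_compose[OF elim(2) gm] by simp
    qed
    show "(\<lambda>\<omega>. U (S \<omega>)) \<in> borel_measurable P"
      unfolding UY using measurable_compose[OF Y gm] .
    have "\<forall>\<^sub>F N in sequentially. integral\<^sup>L (PN N) (\<lambda>\<omega>. ?g (?YN N \<omega>)) = integral\<^sup>L (PN N) (\<lambda>\<omega>. U (SN N \<omega>))"
      using UYN by eventually_elim simp
    then show "(\<lambda>N. integral\<^sup>L (PN N) (\<lambda>\<omega>. U (SN N \<omega>))) \<longlonglongrightarrow> integral\<^sup>L P (\<lambda>\<omega>. U (S \<omega>))"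
      unfolding UY by (rule Lim_transform_eventually[OF c])
  qed

  \<comment> \<open>This concerns the pair \<open>(m, T)\<close> and not the outcome in
    \<open>P\<close>, so the relevant patterns can be collected into a countable family fixed in
    advance.\<close>
  define forced where "forced q m T \<longleftrightarrow> finite T \<and> (\<forall>i\<in>T. d x (e i) \<le> K + mesh m) \<and>
    (\<forall>\<^sub>F N in sequentially. \<forall>\<omega>\<in>space (PN N). pattern d x e K (mesh m) T (SN N \<omega>) > 0 \<longrightarrow> (QN N \<omega> \<longleftrightarrow> q))"
    for q m T

  have cover: "AE \<omega> in P. \<exists>m T. forced (Q \<omega>) m T \<and> pattern d x e K (mesh m) T (S \<omega>) = 1"
  proof -
    have "AE \<omega> in P. \<forall>k. \<exists>\<delta>>0. \<forall>l. \<bar>l - L\<bar> < \<delta> \<longrightarrow>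
        rball_iso (geom_edge d x (M \<omega>) l) x (geom_edge d x (M \<omega>) L) x k"
      using reg L unfolding regular_def by blast
    with simple_root AE_space show ?thesis
    proof eventually_elim
      case (elim \<omega>)
      have MX: "M \<omega> \<subseteq> X" "\<And>r. finite (M \<omega> \<inter> mcball x r)"
        using M elim(2) X unfolding simple_point_process_def by auto
      obtain \<delta> where \<delta>: "\<delta> > 0" "\<And>l. \<bar>l - L\<bar> < \<delta> \<Longrightarrow>
          rball_iso (geom_edge d x (M \<omega>) l) x (geom_edge d x (M \<omega>) L) x (Suc k)"
        using elim(3) by blast
      have exact: "d y z \<noteq> L" if "y \<in> gball (geom_edge d x (M \<omega>) L) x k" "z \<in> insert x (M \<omega>)" for y z
        by (rule no_pair_at_exact_distance[OF X(2) MX(1) MX(2) L \<delta>(1) _ that]) (rule \<delta>(2))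
      define V where "V = M \<omega> \<inter> mcball x K"
      \<comment> \<open>The scale depends on \<open>\<omega>\<close>: distances between atoms have
        no uniform lower bound, so the covering patterns range over all scales.\<close>
      obtain m where sep: "\<And>y z. y \<in> insert x V \<Longrightarrow> z \<in> insert x V \<Longrightarrow> y \<noteq> z \<Longrightarrow> 8 * mesh m < d y z"
        and gap: "\<And>y z. y \<in> insert x V \<Longrightarrow> z \<in> insert x V \<Longrightarrow> d y z \<noteq> L \<Longrightarrow> 8 * mesh m < \<bar>d y z - L\<bar>"
        and shell: "\<And>a. a \<in> M \<omega> \<inter> mcball x (K + 5) \<Longrightarrow> K < d x a \<Longrightarrow> K + 4 * mesh m < d x a"
        using separating_mesh[OF X(2) MX, of K L] unfolding V_def by blast
      define T where "T = approx_index d e (mesh m) ` V"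
      note pat = pattern_of_separated[OF X(2) MX K(1) V_def T_def]
      have T: "finite T" "\<And>i. i \<in> T \<Longrightarrow> d x (e i) \<le> K + mesh m"
          "pattern d x e K (mesh m) T (M \<omega> \<inter> mcball x (K + 5)) = 1"
        by (rule pat; (erule (2) sep | erule (1) shell | assumption))+
      have finV: "finite V" using MX(2) by (simp add: V_def)
      have "\<forall>\<^sub>F N in sequentially. \<forall>\<omega>'\<in>space (PN N). pattern d x e K (mesh m) T (SN N \<omega>') > 0 \<longrightarrow>
          (QN N \<omega>' \<longleftrightarrow> Q \<omega>)"
        using near[OF mesh_pos[of m]]
      proof (eventually_elim, intro ballI impI)
        fix N \<omega>' assume n: "f N ` B' N \<subseteq> B \<and> inj_on (f N) (B' N) \<and> d x (f N (xN N)) \<le> mesh m \<and>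
            (\<forall>y\<in>B' N. \<forall>z\<in>B' N. \<bar>d (f N y) (f N z) - dN N y z\<bar> \<le> mesh m)"
          and \<omega>': "\<omega>' \<in> space (PN N)" and pos: "pattern d x e K (mesh m) T (SN N \<omega>') > 0"
        have MNX: "MN N \<omega>' \<subseteq> XN N" "finite (MN N \<omega>' \<inter> B' N)"
          using MN[of N] \<omega>' XN(2) unfolding simple_point_process_def B'_def by auto
        then have "finite (SN N \<omega>')" by (simp add: SN_def)
        note posD = pattern_posD[OF this T(1) mesh_pos pos]
        have "rball_iso (geom_edge (dN N) (xN N) (MN N \<omega>') L) (xN N) (geom_edge d x (M \<omega>) L) x k"
        proof (rule perturbed_rball_iso[OF X(2) MX(1) elim(1) L V_def[unfolded K_def] finV mesh_pos
              _ _ _ mXN XN(2) MNX(1) B'_def K(3)[unfolded K_def] MNX(2) _ _ _ _ T_def])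
          show "8 * mesh m < d y z" if "y \<in> insert x V" "z \<in> insert x V" "y \<noteq> z" for y z
            using that by (rule sep)
          show "8 * mesh m < \<bar>d y z - L\<bar>" if "y \<in> insert x V" "z \<in> insert x V" "d y z \<noteq> L" for y z
            using that by (rule gap)
          show "d y z \<noteq> L" if "y \<in> gball (geom_edge d x (M \<omega>) L) x k" "z \<in> insert x (M \<omega>)" for y z
            using that by (rule exact)
          show "f N ` B' N \<subseteq> X" using n mcball_subset_mspace unfolding B_def by blast
          show "inj_on (f N) (B' N)" "d x (f N (xN N)) \<le> mesh m" using n by auto
          show "\<bar>d (f N y) (f N z) - dN N y z\<bar> \<le> mesh m" if "y \<in> B' N" "z \<in> B' N" for y z
            using n that by simp
          show "card {b \<in> f N ` (MN N \<omega>' \<inter> B' N). d x b \<le> real k * L + 3 * mesh m} \<le> card T"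
            using posD(2) unfolding SN_def K_def .
          show "\<exists>b\<in>f N ` (MN N \<omega>' \<inter> B' N). d (e i) b < 2 * mesh m" if "i \<in> T" for i
            using posD(1)[OF that] unfolding SN_def .
        qed
        then show "QN N \<omega>' \<longleftrightarrow> Q \<omega>"
          unfolding QN_def Q_def by (rule rball_iso_cong)
      qed
      then have "forced (Q \<omega>) m T"
        unfolding forced_def using T(1,2) by blast
      moreover have "pattern d x e K (mesh m) T (S \<omega>) = 1"
        using T(3) unfolding S_def B_def R_def .
      ultimately show ?case by blast
    qed
  qed

  have lower: "\<forall>\<^sub>F N in sequentially. measure (PN N) {\<omega> \<in> space (PN N). QN N \<omega> \<longleftrightarrow> q} >
      measure P {\<omega> \<in> space P. Q \<omega> \<longleftrightarrow> q} - \<epsilon>" if \<epsilon>: "\<epsilon> > 0" for q \<epsilon>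
  proof -
    define J where "J = {(m, T). forced q m T}"
    \<comment> \<open>The zero functional forces nothing and is inserted so that the family can be
      enumerated even if \<open>J\<close> is empty.\<close>
    define \<G> where "\<G> = insert (\<lambda>_. 0) ((\<lambda>(m, T). pattern d x e K (mesh m) T) ` J)"
    have "J \<subseteq> UNIV \<times> Collect finite" by (auto simp: J_def forced_def)
    then have "countable J"
      by (rule countable_subset) (intro countable_SIGMA countable_Collect_finite uncountable_infinite countableI_type)
    then have cG: "countable \<G>" "\<G> \<noteq> {}" by (auto simp: \<G>_def)
    define G where "G = from_nat_into \<G>"
    have rG: "range G = \<G>" unfolding G_def using cG by (simp add: range_from_nat_into)
    have zero: "(\<lambda>_. 0) \<in> cont_algebra \<Phi>"
      using cont_algebra.comp[OF cont_algebra.gen[OF gen_one] continuous_on_const[of UNIV 0]] by simp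
    have pat: "pattern d x e K (mesh m) T \<in> cont_algebra \<Phi>" if "forced q m T" for m T
      using that K(1) unfolding \<Phi>_def R_def forced_def
      by (intro pattern_in_cont_algebra[OF X]) (auto simp: mesh_le_1)
    have all: "F \<in> cont_algebra \<Phi> \<and> (\<forall>s. 0 \<le> F s \<and> F s \<le> 1) \<and>
       (\<forall>\<^sub>F N in sequentially. \<forall>\<omega>\<in>space (PN N). F (SN N \<omega>) > 0 \<longrightarrow> (QN N \<omega> \<longleftrightarrow> q))" if F: "F \<in> \<G>" for F
    proof (cases "F = (\<lambda>_. 0)")
      case True
      then show ?thesis using zero by simp
    next
      case False
      then obtain m T where F: "F = pattern d x e K (mesh m) T" "forced q m T"
        using F by (auto simp: \<G>_def J_def)
      then show ?thesis
        using pat pattern_nonneg pattern_le_1 by (auto simp: forced_def)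
    qed
    show ?thesis
    proof (rule measure_liminf_lower_bound[where G = G, OF _ _ _ _ _ _ _ \<epsilon>])
      show "{\<omega> \<in> space P. Q \<omega> \<longleftrightarrow> q} \<in> sets P"
        using setsP by (cases q) auto
      show "{\<omega> \<in> space (PN N). QN N \<omega> \<longleftrightarrow> q} \<in> sets (PN N)" for N
        using setsN[of N] by (cases q) auto
      show "G i \<in> cont_algebra \<Phi>" "0 \<le> G i s" "G i s \<le> 1" for i s
        using all[of "G i"] rG by auto
      show "\<forall>\<^sub>F N in sequentially. \<forall>\<omega>\<in>space (PN N). G i (SN N \<omega>) > 0 \<longrightarrow>
          \<omega> \<in> {\<omega> \<in> space (PN N). QN N \<omega> \<longleftrightarrow> q}" for i
        using all[of "G i"] rG by auto
      show "AE \<omega> in P. \<omega> \<in> {\<omega> \<in> space P. Q \<omega> \<longleftrightarrow> q} \<longrightarrow> (\<exists>i. G i (S \<omega>) = 1)"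
        using cover
      proof eventually_elim
        case (elim \<omega>)
        show ?case
        proof
          assume "\<omega> \<in> {\<omega> \<in> space P. Q \<omega> \<longleftrightarrow> q}"
          then obtain m T where mT: "forced q m T" "pattern d x e K (mesh m) T (S \<omega>) = 1"
            using elim by auto
          then have "pattern d x e K (mesh m) T \<in> range G"
            unfolding rG \<G>_def J_def by auto
          then show "\<exists>i. G i (S \<omega>) = 1" using mT(2) by (metis rangeE)
        qed
      qed
    qed
  qed

  have "(\<lambda>N. measure (PN N) {\<omega> \<in> space (PN N). QN N \<omega>}) \<longlonglongrightarrow> measure P {\<omega> \<in> space P. Q \<omega>}"
  proof (rule tendstoI)
    fix \<epsilon> :: real assume \<epsilon>: "\<epsilon> > 0"
    \<comment> \<open>A lower bound for the complement is an upper bound for the event, so the two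
      instances of \<open>lower\<close> enclose the probability.\<close>
    have negP: "measure P {\<omega> \<in> space P. \<not> Q \<omega>} = 1 - measure P {\<omega> \<in> space P. Q \<omega>}"
      using prob_space.prob_neg[OF prob(2) setsP] .
    show "\<forall>\<^sub>F N in sequentially. dist (measure (PN N) {\<omega> \<in> space (PN N). QN N \<omega>})
        (measure P {\<omega> \<in> space P. Q \<omega>}) < \<epsilon>"
      using lower[OF \<epsilon>, of True] lower[OF \<epsilon>, of False]
    proof eventually_elim
      case (elim N)
      have "measure (PN N) {\<omega> \<in> space (PN N). \<not> QN N \<omega>} = 1 - measure (PN N) {\<omega> \<in> space (PN N). QN N \<omega>}"
        using prob_space.prob_neg[OF prob(1) setsN] .
      then show ?case
        using elim negP by (simp add: dist_real_def)
    qed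
  qed
  then show "(\<lambda>N. measure (PN N) {\<omega> \<in> space (PN N). rball_iso (geom_edge (dN N) (xN N) (MN N \<omega>) L) (xN N) H h0 k})
      \<longlonglongrightarrow> measure P {\<omega> \<in> space P. rball_iso (geom_edge d x (M \<omega>) L) x H h0 k}"
    by (simp add: Q_def QN_def)
qed

end
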